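(* Let $\Gamma$ be any countable graph. There are $2^{\aleph_0}$ non-regular $\mathscr{D}$-classes of the endomorphism monoid of the countable universal bipartite graph $B$ such that the Schützenberger groups of $\mathscr{H}$-classes within them are isomorphic to $\operatorname{Aut}\Gamma$.
   Context: A graph is a pair $(V,E)$ with $E$ an irreflexive symmetric binary relation on $V$. A bipartite graph is a relational structure $(V,E,P)$ where $E$ is an irreflexive symmetric binary relation on $V$, $P=(V_0\times V_0)\cup(V_1\times V_1)$ for some partition $V=V_0\,\dot\cup\,V_1$, and $(u,v)\in E$ implies $(u,v)\notin P$; homomorphisms preserve both $E$ and $P$. The countable universal bipartite graph $B$ is the Fraïssé limit of the finite bipartite graphs in this sense. $\operatorname{End} B$ is its endomorphism monoid, maps on the right. Green's relations on a monoid $M$: $f\,\mathscr{L}\,g$ iff $Mf=Mg$; $f\,\mathscr{R}\,g$ iff $fM=gM$; $\mathscr{H}=\mathscr{L}\cap\mathscr{R}$; $\mathscr{D}=\mathscr{L}\circ\mathscr{R}$. An element $f$ is regular if $fgf=f$ for some $g\in M$; a non-regular $\mathscr{D}$-class consists of non-regular elements. For an $\mathscr{H}$-class $H$, let $T_H=\{t\in M:Ht\subseteq H\}$ and $\gamma_t:H\to H$, $h\mapsto ht$; the Schützenberger group of $H$ is $\{\gamma_t:t\in T_H\}$. *)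

theory Defs
  imports
    "HOL-Algebra.Coset"
    "HOL-Library.Countable_Set"
    "HOL-Library.Equipollence"
begin

definition graph :: "'a set \<Rightarrow> ('a \<times> 'a) set \<Rightarrow> bool"
  where "graph V E \<longleftrightarrow> E \<subseteq> V \<times> V \<and> irrefl E \<and> sym E"

text \<open>Maps act on the right throughout: the product of \<open>f\<close> and \<open>g\<close> is
  \<open>f\<close> followed by \<open>g\<close>, i.e. \<open>compose V g f\<close>. Maps are extensional
  outside their domain, so that equality of maps is equality of functions.\<close>

definition Aut_graph :: "'a set \<Rightarrow> ('a \<times> 'a) set \<Rightarrow> ('a \<Rightarrow> 'a) monoid"
  where "Aut_graph V E =
    \<lparr>carrier = {f \<in> extensional V. bij_betw f V V \<and>
                 (\<forall>u\<in>V. \<forall>v\<in>V. (f u, f v) \<in> E \<longleftrightarrow> (u, v) \<in> E)},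
     monoid.mult = (\<lambda>f g. compose V g f),
     one = (\<lambda>x\<in>V. x)\<rparr>"

record 'a bstruct =
  verts :: "'a set"
  edges :: "('a \<times> 'a) set"
  same_part :: "('a \<times> 'a) set"

definition is_structure :: "'a bstruct \<Rightarrow> bool"
  where "is_structure A \<longleftrightarrow>
    edges A \<subseteq> verts A \<times> verts A \<and> same_part A \<subseteq> verts A \<times> verts A"

text \<open>One (or both) of the two parts may be empty.\<close>

definition bipartite_graph :: "'a bstruct \<Rightarrow> bool"
  where "bipartite_graph A \<longleftrightarrow>
    is_structure A \<and> irrefl (edges A) \<and> sym (edges A) \<and>
    (\<exists>V0 V1. verts A = V0 \<union> V1 \<and> V0 \<inter> V1 = {} \<and>
       same_part A = V0 \<times> V0 \<union> V1 \<times> V1) \<and>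
    (\<forall>u v. (u, v) \<in> edges A \<longrightarrow> (u, v) \<notin> same_part A)"

definition homomorphism :: "'a bstruct \<Rightarrow> 'b bstruct \<Rightarrow> ('a \<Rightarrow> 'b) \<Rightarrow> bool"
  where "homomorphism A B f \<longleftrightarrow>
    f \<in> verts A \<rightarrow> verts B \<and>
    (\<forall>u v. (u, v) \<in> edges A \<longrightarrow> (f u, f v) \<in> edges B) \<and>
    (\<forall>u v. (u, v) \<in> same_part A \<longrightarrow> (f u, f v) \<in> same_part B)"

definition embedding :: "'a bstruct \<Rightarrow> 'b bstruct \<Rightarrow> ('a \<Rightarrow> 'b) \<Rightarrow> bool"
  where "embedding A B f \<longleftrightarrow>
    f \<in> verts A \<rightarrow> verts B \<and> inj_on f (verts A) \<and>
    (\<forall>u\<in>verts A. \<forall>v\<in>verts A. (f u, f v) \<in> edges B \<longleftrightarrow> (u, v) \<in> edges A) \<and>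
    (\<forall>u\<in>verts A. \<forall>v\<in>verts A. (f u, f v) \<in> same_part B \<longleftrightarrow> (u, v) \<in> same_part A)"

definition isomorphism :: "'a bstruct \<Rightarrow> 'b bstruct \<Rightarrow> ('a \<Rightarrow> 'b) \<Rightarrow> bool"
  where "isomorphism A B f \<longleftrightarrow> embedding A B f \<and> f ` verts A = verts B"

definition induced :: "'a bstruct \<Rightarrow> 'a set \<Rightarrow> 'a bstruct"
  where "induced A X =
    \<lparr>verts = X, edges = edges A \<inter> X \<times> X, same_part = same_part A \<inter> X \<times> X\<rparr>"

definition End_monoid :: "'a bstruct \<Rightarrow> ('a \<Rightarrow> 'a) monoid"
  where "End_monoid A =
    \<lparr>carrier = {f \<in> extensional (verts A). homomorphism A A f},
     monoid.mult = (\<lambda>f g. compose (verts A) g f),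
     one = (\<lambda>x\<in>verts A. x)\<rparr>"

text \<open>Every finite structure has an isomorphic copy with vertices in \<open>nat\<close>, so
  isomorphism-closed classes of finite structures are represented by their members
  over \<open>nat\<close>.\<close>

definition age :: "'a bstruct \<Rightarrow> nat bstruct set"
  where "age B = {A. is_structure A \<and> finite (verts A) \<and> (\<exists>f. embedding A B f)}"

definition homogeneous :: "'a bstruct \<Rightarrow> bool"
  where "homogeneous B \<longleftrightarrow>
    (\<forall>X Y f. finite X \<and> X \<subseteq> verts B \<and> finite Y \<and> Y \<subseteq> verts B \<and>
       isomorphism (induced B X) (induced B Y) f \<longrightarrow>
       (\<exists>g. isomorphism B B g \<and> (\<forall>x\<in>X. g x = f x)))"

definition Fraisse_limit :: "nat bstruct set \<Rightarrow> 'a bstruct \<Rightarrow> bool"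
  where "Fraisse_limit K B \<longleftrightarrow>
    is_structure B \<and> countable (verts B) \<and> age B = K \<and> homogeneous B"

definition universal_bipartite_graph :: "'a bstruct \<Rightarrow> bool"
  where "universal_bipartite_graph B \<longleftrightarrow>
    Fraisse_limit {A. bipartite_graph A \<and> finite (verts A)} B"

definition Green_L :: "('a, 'b) monoid_scheme \<Rightarrow> ('a \<times> 'a) set"
  where "Green_L M = {(f, g). f \<in> carrier M \<and> g \<in> carrier M \<and>
    carrier M #>\<^bsub>M\<^esub> f = carrier M #>\<^bsub>M\<^esub> g}"

definition Green_R :: "('a, 'b) monoid_scheme \<Rightarrow> ('a \<times> 'a) set"
  where "Green_R M = {(f, g). f \<in> carrier M \<and> g \<in> carrier M \<and>
    f <#\<^bsub>M\<^esub> carrier M = g <#\<^bsub>M\<^esub> carrier M}"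

definition Green_H :: "('a, 'b) monoid_scheme \<Rightarrow> ('a \<times> 'a) set"
  where "Green_H M = Green_L M \<inter> Green_R M"

definition Green_D :: "('a, 'b) monoid_scheme \<Rightarrow> ('a \<times> 'a) set"
  where "Green_D M = Green_L M O Green_R M"

definition regular_element :: "('a, 'b) monoid_scheme \<Rightarrow> 'a \<Rightarrow> bool"
  where "regular_element M f \<longleftrightarrow> (\<exists>g\<in>carrier M. f \<otimes>\<^bsub>M\<^esub> g \<otimes>\<^bsub>M\<^esub> f = f)"

definition H_classes :: "('a, 'b) monoid_scheme \<Rightarrow> 'a set set"
  where "H_classes M = carrier M // Green_H M"

definition nonregular_D_classes :: "('a, 'b) monoid_scheme \<Rightarrow> 'a set set"
  where "nonregular_D_classes M =
    {D \<in> carrier M // Green_D M. \<forall>f\<in>D. \<not> regular_element M f}"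

definition Schuetzenberger_group ::
    "('a, 'b) monoid_scheme \<Rightarrow> 'a set \<Rightarrow> ('a \<Rightarrow> 'a) monoid"
  where "Schuetzenberger_group M H =
    \<lparr>carrier = {(\<lambda>h\<in>H. h \<otimes>\<^bsub>M\<^esub> t) | t. t \<in> carrier M \<and> H #>\<^bsub>M\<^esub> t \<subseteq> H},
     monoid.mult = (\<lambda>\<alpha> \<beta>. compose H \<beta> \<alpha>),
     one = (\<lambda>h\<in>H. h)\<rparr>"

end

theory Submission
  imports Defs
begin

text \<open>For an endomorphism \<open>f\<close> of \<open>B\<close> consider two relations on its image: \<open>R2\<close>, induced by the
  edges of \<open>B\<close>, and \<open>R1 \<subseteq> R2\<close>, the images of edges under \<open>f\<close>. The structure \<open>(im f, R1, R2)\<close>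
  (with its parts) depends, up to isomorphism, only on the \<open>D\<close>-class of \<open>f\<close>, and \<open>f\<close> is not
  regular as soon as \<open>R1 \<noteq> R2\<close>. A member of the Schuetzenberger group restricts to an automorphism
  of this structure; conversely an automorphism comes from the group if it extends from the image
  to an endomorphism of \<open>B\<close> and lifts through \<open>f\<close>.

  Every countably infinite pair \<open>R1 \<subseteq> R2\<close> of bipartite relations such that finitely many vertices
  in one part always have a common \<open>R1\<close>-neighbour, and such that all automorphisms fix the parts,
  arises in this way, with all automorphisms extending and lifting. Extension is achieved by
  embedding \<open>R2\<close> so that each vertex outside the image has only finitely many neighbours in it,
  and lifting by giving \<open>f\<close> rich fibres; the extending and lifting maps are only endomorphisms, so
  a single pass through the vertices of \<open>B\<close> constructs them. It remains to encode the graph \<open>\<Gamma>\<close>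
  together with a set of natural numbers in such a pair.\<close>

section \<open>The extension property of the universal bipartite graph\<close>

text \<open>The predicate \<open>q\<close> names one of the two parts: the structure itself only knows whether
  two vertices lie in the same part.\<close>

locale generic_bipartite =
  fixes B :: "'b bstruct" and q :: "'b \<Rightarrow> bool"
  assumes countable_verts: "countable (verts B)"
    and edge_verts: "(u, v) \<in> edges B \<Longrightarrow> u \<in> verts B \<and> v \<in> verts B"
    and edge_sym: "(u, v) \<in> edges B \<Longrightarrow> (v, u) \<in> edges B"
    and edge_parts: "(u, v) \<in> edges B \<Longrightarrow> q u \<noteq> q v"
    and same_part_iff: "(u, v) \<in> same_part B \<longleftrightarrow> u \<in> verts B \<and> v \<in> verts B \<and> q u = q v"
    and extension:
      "\<lbrakk>finite U; U \<subseteq> verts B; finite N; N \<subseteq> verts B; U \<inter> N = {}; \<forall>u\<in>U. q u = c\<rbrakk> \<Longrightarrow>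
        \<exists>v \<in> verts B - (U \<union> N). q v = (\<not> c) \<and>
          (\<forall>u\<in>U. (v, u) \<in> edges B) \<and> (\<forall>u\<in>N. (v, u) \<notin> edges B)"

text \<open>The age consists of structures over \<open>nat\<close>, so a finite set of vertices is
  compared with it through an enumeration \<open>g\<close>.\<close>

definition pullback :: "nat set \<Rightarrow> (nat \<Rightarrow> 'b) \<Rightarrow> 'b bstruct \<Rightarrow> nat bstruct"
  where "pullback I g B = \<lparr>verts = I, edges = {(i, j). i \<in> I \<and> j \<in> I \<and> (g i, g j) \<in> edges B},
    same_part = {(i, j). i \<in> I \<and> j \<in> I \<and> (g i, g j) \<in> same_part B}\<rparr>"

lemma pullback_in_age:
  assumes "finite I" "g \<in> I \<rightarrow> verts B" "inj_on g I"
  shows "pullback I g B \<in> age B"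
proof -
  have "embedding (pullback I g B) B g"
    using assms by (auto simp: pullback_def embedding_def)
  then show ?thesis
    using assms(1) by (auto simp: age_def pullback_def is_structure_def)
qed

text \<open>A finite induced substructure has a copy in the age and is therefore bipartite;
  \<open>c\<close> is its partition carried back to \<open>X\<close>. Applied to three vertices at a
  time, this yields the global axioms on edges and parts.\<close>

lemma finite_sub_bipartite:
  assumes B: "universal_bipartite_graph B" and X: "finite X" "X \<subseteq> verts B"
  obtains c where
    "\<forall>u\<in>X. \<forall>v\<in>X. (u, v) \<in> same_part B \<longleftrightarrow> c u = c v"
    "\<forall>u\<in>X. \<forall>v\<in>X. (u, v) \<in> edges B \<longrightarrow> (v, u) \<in> edges B \<and> c u \<noteq> (c v :: bool)"
proof -
  obtain g where g: "bij_betw g {0..<card X} X"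
    using ex_bij_betw_nat_finite[OF X(1)] by blast
  let ?I = "{0..<card X}"
  let ?A = "pullback ?I g B"
  have "?A \<in> age B"
    using g X by (intro pullback_in_age) (auto simp: bij_betw_def)
  then have "bipartite_graph ?A"
    using B unfolding universal_bipartite_graph_def Fraisse_limit_def by auto
  moreover have "verts ?A = ?I" by (simp add: pullback_def)
  ultimately obtain V0 V1 where V: "?I = V0 \<union> V1" "V0 \<inter> V1 = {}"
      "same_part ?A = V0 \<times> V0 \<union> V1 \<times> V1" and s: "sym (edges ?A)"
      and e: "\<forall>u v. (u, v) \<in> edges ?A \<longrightarrow> (u, v) \<notin> same_part ?A"
    unfolding bipartite_graph_def by metis
  define h where "h = inv_into ?I g"
  have h: "h u \<in> ?I" "g (h u) = u" if "u \<in> X" for u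
    using that g unfolding h_def bij_betw_def
    by (metis inv_into_into, metis f_inv_into_f)
  define c where "c u = (h u \<in> V0)" for u
  have sp: "(u, v) \<in> same_part B \<longleftrightarrow> (h u, h v) \<in> same_part ?A" if "u \<in> X" "v \<in> X" for u v
    using h[OF that(1)] h[OF that(2)] by (auto simp: pullback_def)
  have ed: "(u, v) \<in> edges B \<longleftrightarrow> (h u, h v) \<in> edges ?A" if "u \<in> X" "v \<in> X" for u v
    using h[OF that(1)] h[OF that(2)] by (auto simp: pullback_def)
  have hV: "h u \<in> V1 \<longleftrightarrow> \<not> c u" if "u \<in> X" for u
    using h[OF that] V unfolding c_def by blast
  have 1: "\<forall>u\<in>X. \<forall>v\<in>X. (u, v) \<in> same_part B \<longleftrightarrow> c u = c v"
    using sp hV V(3) unfolding c_def by auto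
  moreover have "\<forall>u\<in>X. \<forall>v\<in>X. (u, v) \<in> edges B \<longrightarrow> (v, u) \<in> edges B \<and> c u \<noteq> c v"
    using 1 sp ed e symD[OF s] by metis
  ultimately show thesis by (rule that)
qed

text \<open>The usual passage from a Fraisse limit to one-point extensions: the desired finite
  structure lies in the age, hence embeds into \<open>B\<close>, and homogeneity moves the embedded
  copy onto the given vertices.\<close>

lemma universal_bipartite_graph_generic:
  fixes B :: "'b bstruct"
  assumes B: "universal_bipartite_graph B"
  shows "\<exists>q. generic_bipartite B q"
proof -
  let ?W = "verts B"
  have str: "is_structure B" and cnt: "countable ?W" and hom: "homogeneous B"
    and age: "age B = {A. bipartite_graph A \<and> finite (verts A)}"
    using B by (auto simp: universal_bipartite_graph_def Fraisse_limit_def)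
  have ed_W: "u \<in> ?W \<and> v \<in> ?W" if "(u, v) \<in> edges B" for u v
    using str that by (auto simp: is_structure_def)
  have sp_W: "u \<in> ?W \<and> v \<in> ?W" if "(u, v) \<in> same_part B" for u v
    using str that by (auto simp: is_structure_def)
  \<comment> \<open>The one-vertex structure shows that \<open>B\<close> is nonempty; the part of
    the resulting base point \<open>v0\<close> is the one named by \<open>q\<close>.\<close>
  let ?pt = "\<lparr>verts = {0}, edges = {}, same_part = {(0, 0)}\<rparr> :: nat bstruct"
  have "\<exists>V0 V1. {0} = V0 \<union> V1 \<and> V0 \<inter> V1 = {} \<and> {(0, 0 :: nat)} = V0 \<times> V0 \<union> V1 \<times> V1"
    by (rule exI[of _ "{0}"], rule exI[of _ "{}"]) auto
  then have "bipartite_graph ?pt"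
    by (simp add: bipartite_graph_def is_structure_def irrefl_def sym_def)
  then have "?pt \<in> age B" using age by simp
  then obtain v0 where v0: "v0 \<in> ?W"
    by (auto simp: age_def embedding_def)
  define q where "q v = ((v, v0) \<in> same_part B)" for v
  have part: "(u, v) \<in> same_part B \<longleftrightarrow> q u = q v"
    and ed_sym: "(u, v) \<in> edges B \<Longrightarrow> (v, u) \<in> edges B"
    and ed_part: "(u, v) \<in> edges B \<Longrightarrow> q u \<noteq> q v"
    if "u \<in> ?W" "v \<in> ?W" for u v
  proof -
    have "finite {u, v, v0}" "{u, v, v0} \<subseteq> ?W" using that v0 by auto
    then obtain c where c: "\<forall>x\<in>{u, v, v0}. \<forall>y\<in>{u, v, v0}. (x, y) \<in> same_part B \<longleftrightarrow> c x = c y"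
      "\<forall>x\<in>{u, v, v0}. \<forall>y\<in>{u, v, v0}. (x, y) \<in> edges B \<longrightarrow> (y, x) \<in> edges B \<and> c x \<noteq> (c y :: bool)"
      by (rule finite_sub_bipartite[OF B]) blast
    show eq: "(u, v) \<in> same_part B \<longleftrightarrow> q u = q v" using c(1) unfolding q_def by auto
    show "(v, u) \<in> edges B" if "(u, v) \<in> edges B" using c(2) that by blast
    have "(u, v) \<notin> same_part B" if "(u, v) \<in> edges B" using c that by blast
    then show "q u \<noteq> q v" if "(u, v) \<in> edges B" using eq that by blast
  qed
  have ext: "\<exists>v \<in> ?W - (U \<union> N). q v = (\<not> c) \<and>
          (\<forall>u\<in>U. (v, u) \<in> edges B) \<and> (\<forall>u\<in>N. (v, u) \<notin> edges B)"
    if U: "finite U" "U \<subseteq> ?W" and N: "finite N" "N \<subseteq> ?W" and disj: "U \<inter> N = {}"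
      and c: "\<forall>u\<in>U. q u = c" for U N c
  proof -
    \<comment> \<open>The base point is included so that the part of the new vertex can be read off,
      even when \<open>U\<close> and \<open>N\<close> are empty.\<close>
    define X where "X = insert v0 (U \<union> N)"
    have X: "finite X" "X \<subseteq> ?W" using U N v0 unfolding X_def by auto
    obtain g where g: "bij_betw g {0..<card X} X"
      using ex_bij_betw_nat_finite[OF X(1)] by blast
    define n where "n = card X"
    have gX: "i < n \<Longrightarrow> g i \<in> X" for i
      using g unfolding n_def bij_betw_def by auto
    have gU: "g i \<in> U \<Longrightarrow> q (g i) = c" for i using c by blast
    \<comment> \<open>\<open>?A\<close> copies the structure on \<open>X\<close> to the indices
      below \<open>n\<close> and adds a vertex \<open>n\<close> on the side \<open>\<not> c\<close>,
      adjacent to exactly the indices of \<open>U\<close>.\<close>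
    define s where "s i = (if i < n then q (g i) else \<not> c)" for i
    define e where "e i j = ((i < n \<and> j < n \<and> (g i, g j) \<in> edges B) \<or>
      (i = n \<and> j < n \<and> g j \<in> U) \<or> (j = n \<and> i < n \<and> g i \<in> U))" for i j
    let ?A = "\<lparr>verts = {..n}, edges = {(i, j). i \<le> n \<and> j \<le> n \<and> e i j},
      same_part = {(i, j). i \<le> n \<and> j \<le> n \<and> s i = s j}\<rparr>"
    have e_sym: "e i j \<Longrightarrow> e j i" for i j
      using ed_sym ed_W unfolding e_def by blast
    have e_s: "e i j \<Longrightarrow> s i \<noteq> s j" for i j
      using ed_part ed_W gU unfolding e_def s_def by auto
    have "bipartite_graph ?A"
      unfolding bipartite_graph_def
    proof (intro conjI)
      show "\<exists>V0 V1. verts ?A = V0 \<union> V1 \<and> V0 \<inter> V1 = {} \<and> same_part ?A = V0 \<times> V0 \<union> V1 \<times> V1"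
        by (rule exI[of _ "{i. i \<le> n \<and> s i}"], rule exI[of _ "{i. i \<le> n \<and> \<not> s i}"]) auto
    qed (use e_sym e_s in \<open>auto simp: is_structure_def irrefl_def sym_def\<close>)
    then have "?A \<in> age B" using age by simp
    then obtain k where k: "embedding ?A B k" unfolding age_def by auto
    then have kW: "i \<le> n \<Longrightarrow> k i \<in> ?W" and k_inj: "inj_on k {..n}"
      and k_ed: "i \<le> n \<Longrightarrow> j \<le> n \<Longrightarrow> (k i, k j) \<in> edges B \<longleftrightarrow> e i j"
      and k_sp: "i \<le> n \<Longrightarrow> j \<le> n \<Longrightarrow> (k i, k j) \<in> same_part B \<longleftrightarrow> s i = s j" for i j
      unfolding embedding_def by auto
    define Y where "Y = k ` {..<n}"
    have k_inj': "inj_on k {..<n}" using k_inj by (rule inj_on_subset) auto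
    \<comment> \<open>\<open>f\<close> sends the embedded copy \<open>Y\<close> of \<open>X\<close>
      back to \<open>X\<close>. An automorphism \<open>h\<close> extending it takes
      \<open>k n\<close> to the required vertex.\<close>
    define f where "f = g \<circ> inv_into {..<n} k"
    have fk: "i < n \<Longrightarrow> f (k i) = g i" for i
      using k_inj' unfolding f_def by (simp add: inv_into_f_f)
    have g_inj: "i < n \<Longrightarrow> j < n \<Longrightarrow> g i = g j \<Longrightarrow> i = j" for i j
      using g unfolding n_def bij_betw_def by (auto dest: inj_onD)
    have XW: "i < n \<Longrightarrow> g i \<in> ?W" for i using gX X(2) by blast
    have "isomorphism (induced B Y) (induced B X) f"
      unfolding isomorphism_def embedding_def
    proof (intro conjI)
      show "inj_on f (verts (induced B Y))"
        unfolding inj_on_def by (auto simp: induced_def Y_def fk dest: g_inj)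
      show "f ` verts (induced B Y) = verts (induced B X)"
      proof -
        have "f ` Y = g ` {..<n}" unfolding Y_def image_image using fk by (intro image_cong) auto
        also have "\<dots> = X" using g unfolding n_def bij_betw_def by (simp add: lessThan_atLeast0)
        finally show ?thesis by (simp add: induced_def)
      qed
      show "f \<in> verts (induced B Y) \<rightarrow> verts (induced B X)"
        using gX by (auto simp: induced_def Y_def fk)
      show "\<forall>u\<in>verts (induced B Y). \<forall>v\<in>verts (induced B Y).
          (f u, f v) \<in> edges (induced B X) \<longleftrightarrow> (u, v) \<in> edges (induced B Y)"
        using gX by (auto simp: induced_def Y_def fk k_ed e_def)
      show "\<forall>u\<in>verts (induced B Y). \<forall>v\<in>verts (induced B Y).
          (f u, f v) \<in> same_part (induced B X) \<longleftrightarrow> (u, v) \<in> same_part (induced B Y)"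
        using gX by (auto simp: induced_def Y_def fk k_sp s_def part XW)
    qed
    moreover have "finite Y" "Y \<subseteq> ?W" using kW unfolding Y_def by auto
    ultimately obtain h where h: "isomorphism B B h" and hf: "\<forall>y\<in>Y. h y = f y"
      using hom X unfolding homogeneous_def by meson
    have hk: "i < n \<Longrightarrow> h (k i) = g i" for i using hf fk unfolding Y_def by auto
    have h_inj: "inj_on h ?W" and hW: "w \<in> ?W \<Longrightarrow> h w \<in> ?W"
      and h_ed: "u \<in> ?W \<Longrightarrow> w \<in> ?W \<Longrightarrow> (h u, h w) \<in> edges B \<longleftrightarrow> (u, w) \<in> edges B"
      and h_sp: "u \<in> ?W \<Longrightarrow> w \<in> ?W \<Longrightarrow> (h u, h w) \<in> same_part B \<longleftrightarrow> (u, w) \<in> same_part B" for u w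
      using h unfolding isomorphism_def embedding_def by auto
    have Xg: "\<exists>i<n. x = g i" if "x \<in> X" for x
      using that g unfolding n_def bij_betw_def by force
    let ?v = "h (k n)"
    have vW: "?v \<in> ?W" using hW kW by simp
    have v_new: "?v \<noteq> g i" if "i < n" for i
    proof
      assume "?v = g i"
      then have "h (k n) = h (k i)" using hk that by simp
      then have "k n = k i" using h_inj kW that by (simp add: inj_on_eq_iff)
      then show False using k_inj that by (simp add: inj_on_eq_iff)
    qed
    have v_ed: "(?v, g i) \<in> edges B \<longleftrightarrow> g i \<in> U" if "i < n" for i
      using h_ed[of "k n" "k i"] hk[OF that] kW that k_ed[of n i] by (auto simp: e_def)
    have v_sp: "(?v, g i) \<in> same_part B \<longleftrightarrow> q (g i) = (\<not> c)" if "i < n" for i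
      using h_sp[of "k n" "k i"] hk[OF that] kW that k_sp[of n i] by (auto simp: s_def)
    have "q v0" using part[OF v0 v0] unfolding q_def by simp
    moreover obtain i where "i < n" "v0 = g i" using Xg[of v0] unfolding X_def by auto
    ultimately have "q ?v = (\<not> c)" using v_sp[of i] unfolding q_def by auto
    moreover have "?v \<notin> U \<union> N" using Xg v_new unfolding X_def by blast
    moreover have "\<forall>u\<in>U. (?v, u) \<in> edges B" using Xg v_ed unfolding X_def by blast
    moreover have "\<forall>u\<in>N. (?v, u) \<notin> edges B" using Xg v_ed disj unfolding X_def by blast
    ultimately show ?thesis using vW by blast
  qed
  have "generic_bipartite B q"
    by unfold_locales
      (use cnt ed_W sp_W ed_sym ed_part part ext in blast)+
  then show ?thesis by blast
qed

section \<open>Green's relations\<close>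

text \<open>The unit puts each element into its own principal ideal, so equality of the ideals is
  mutual divisibility.\<close>

lemma (in monoid) Green_L_iff:
  "(f, g) \<in> Green_L G \<longleftrightarrow> f \<in> carrier G \<and> g \<in> carrier G \<and>
    (\<exists>a\<in>carrier G. g = a \<otimes> f) \<and> (\<exists>b\<in>carrier G. f = b \<otimes> g)"
proof
  assume "(f, g) \<in> Green_L G"
  then have c: "f \<in> carrier G" "g \<in> carrier G" and e: "carrier G #> f = carrier G #> g"
    by (auto simp: Green_L_def)
  have "f \<in> carrier G #> f" "g \<in> carrier G #> g"
    unfolding r_coset_def using c by (auto intro!: bexI[of _ \<one>])
  then show "f \<in> carrier G \<and> g \<in> carrier G \<and>
    (\<exists>a\<in>carrier G. g = a \<otimes> f) \<and> (\<exists>b\<in>carrier G. f = b \<otimes> g)"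
    using c e unfolding r_coset_def by auto
next
  assume *: "f \<in> carrier G \<and> g \<in> carrier G \<and>
    (\<exists>a\<in>carrier G. g = a \<otimes> f) \<and> (\<exists>b\<in>carrier G. f = b \<otimes> g)"
  then obtain a b where ab: "a \<in> carrier G" "g = a \<otimes> f" "b \<in> carrier G" "f = b \<otimes> g" by blast
  have c: "f \<in> carrier G" "g \<in> carrier G" using * by auto
  have 1: "x \<otimes> f = (x \<otimes> b) \<otimes> g" "x \<otimes> g = (x \<otimes> a) \<otimes> f" if "x \<in> carrier G" for x
    using ab c that by (metis m_assoc)+
  have "carrier G #> f \<subseteq> carrier G #> g" "carrier G #> g \<subseteq> carrier G #> f"
    unfolding r_coset_def using 1 m_closed ab(1,3) by blast+
  then show "(f, g) \<in> Green_L G" using * by (auto simp: Green_L_def)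
qed

lemma (in monoid) Green_R_iff:
  "(f, g) \<in> Green_R G \<longleftrightarrow> f \<in> carrier G \<and> g \<in> carrier G \<and>
    (\<exists>a\<in>carrier G. g = f \<otimes> a) \<and> (\<exists>b\<in>carrier G. f = g \<otimes> b)"
proof
  assume "(f, g) \<in> Green_R G"
  then have c: "f \<in> carrier G" "g \<in> carrier G" and e: "f <# carrier G = g <# carrier G"
    by (auto simp: Green_R_def)
  have "f \<in> f <# carrier G" "g \<in> g <# carrier G"
    unfolding l_coset_def using c by (auto intro!: bexI[of _ \<one>])
  then show "f \<in> carrier G \<and> g \<in> carrier G \<and>
    (\<exists>a\<in>carrier G. g = f \<otimes> a) \<and> (\<exists>b\<in>carrier G. f = g \<otimes> b)"
    using c e unfolding l_coset_def by auto
next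
  assume *: "f \<in> carrier G \<and> g \<in> carrier G \<and>
    (\<exists>a\<in>carrier G. g = f \<otimes> a) \<and> (\<exists>b\<in>carrier G. f = g \<otimes> b)"
  then obtain a b where ab: "a \<in> carrier G" "g = f \<otimes> a" "b \<in> carrier G" "f = g \<otimes> b" by blast
  have c: "f \<in> carrier G" "g \<in> carrier G" using * by auto
  have 1: "f \<otimes> x = g \<otimes> (b \<otimes> x)" "g \<otimes> x = f \<otimes> (a \<otimes> x)" if "x \<in> carrier G" for x
    using ab c that by (metis m_assoc)+
  have "f <# carrier G \<subseteq> g <# carrier G" "g <# carrier G \<subseteq> f <# carrier G"
    unfolding l_coset_def using 1 m_closed ab(1,3) by blast+
  then show "(f, g) \<in> Green_R G" using * by (auto simp: Green_R_def)
qed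

lemma (in monoid) Green_D_refl: "f \<in> carrier G \<Longrightarrow> (f, f) \<in> Green_D G"
  by (auto simp: Green_D_def Green_L_def Green_R_def)

lemma (in monoid) Green_H_refl: "f \<in> carrier G \<Longrightarrow> (f, f) \<in> Green_H G"
  by (auto simp: Green_H_def Green_L_def Green_R_def)

text \<open>An instance of Green's lemma: with \<open>g = a \<otimes> f\<close>, left multiplication
  by \<open>a\<close> commutes with right multiplication by \<open>t\<close>, and an
  \<open>s\<close> undoing \<open>t\<close> at \<open>f\<close> also undoes it at \<open>g\<close>.
  Thus membership of \<open>t\<close> in the stabiliser of a class can be tested on one
  element.\<close>

lemma (in monoid) Green_H_class_stable:
  assumes t: "t \<in> carrier G" and ft: "(f, f \<otimes> t) \<in> Green_H G" and g: "(f, g) \<in> Green_H G"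
  shows "(f, g \<otimes> t) \<in> Green_H G"
proof -
  have fL: "(f, f \<otimes> t) \<in> Green_L G" and fR: "(f, f \<otimes> t) \<in> Green_R G"
    and gL: "(f, g) \<in> Green_L G" and gR: "(f, g) \<in> Green_R G"
    using ft g by (auto simp: Green_H_def)
  have c: "f \<in> carrier G" "g \<in> carrier G" using gL by (auto simp: Green_L_def)
  obtain a b where ab: "a \<in> carrier G" "g = a \<otimes> f" "b \<in> carrier G" "f = b \<otimes> g"
    using gL unfolding Green_L_iff by blast
  obtain s where s: "s \<in> carrier G" "f = f \<otimes> t \<otimes> s"
    using fR unfolding Green_R_iff by blast
  have "g \<otimes> t = a \<otimes> (f \<otimes> t)" "f \<otimes> t = b \<otimes> (g \<otimes> t)"
    using ab c t by (metis m_assoc)+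
  then have "(f \<otimes> t, g \<otimes> t) \<in> Green_L G"
    unfolding Green_L_iff using ab c t by blast
  then have L: "(f, g \<otimes> t) \<in> Green_L G" using fL by (auto simp: Green_L_def)
  have "g = g \<otimes> t \<otimes> s"
    using ab(1,2) s c t by (metis m_assoc m_closed)
  then have "(g, g \<otimes> t) \<in> Green_R G"
    unfolding Green_R_iff using c t s by blast
  then have "(f, g \<otimes> t) \<in> Green_R G" using gR by (auto simp: Green_R_def)
  with L show ?thesis by (simp add: Green_H_def)
qed

text \<open>Closure of \<open>G\<close> puts the product of two preimages into the carrier, where
  \<open>h\<close> can be cancelled. Isomorphisms can then be reversed before either side is known
  to be a group.\<close>

lemma is_iso_sym_closed:
  assumes "G \<cong> H" and closed: "\<And>x y. x \<in> carrier G \<Longrightarrow> y \<in> carrier G \<Longrightarrow> x \<otimes>\<^bsub>G\<^esub> y \<in> carrier G"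
  shows "H \<cong> G"
proof -
  obtain h where h: "h \<in> hom G H" "bij_betw h (carrier G) (carrier H)"
    using assms(1) unfolding is_iso_def iso_def by blast
  let ?k = "inv_into (carrier G) h"
  have k: "bij_betw ?k (carrier H) (carrier G)" using h(2) by (rule bij_betw_inv_into)
  have hk: "h (?k y) = y" if "y \<in> carrier H" for y
    using h(2) that by (simp add: bij_betw_inv_into_right)
  have kc: "?k y \<in> carrier G" if "y \<in> carrier H" for y
    using k that by (auto simp: bij_betw_def)
  have "?k (x \<otimes>\<^bsub>H\<^esub> y) = ?k x \<otimes>\<^bsub>G\<^esub> ?k y" if xy: "x \<in> carrier H" "y \<in> carrier H" for x y
  proof -
    have "x \<otimes>\<^bsub>H\<^esub> y = h (?k x \<otimes>\<^bsub>G\<^esub> ?k y)"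
      using h(1) kc hk xy by (simp add: hom_mult)
    then show ?thesis
      using h(2) closed kc xy by (simp add: bij_betw_inv_into_left)
  qed
  then have "?k \<in> iso H G" using k kc by (auto simp: iso_def hom_def)
  then show ?thesis by (auto simp: is_iso_def)
qed

section \<open>The monoid of endomorphisms\<close>

lemma End_carrier_iff:
  "f \<in> carrier (End_monoid B) \<longleftrightarrow> f \<in> extensional (verts B) \<and> homomorphism B B f"
  by (simp add: End_monoid_def)

lemma End_mult [simp]: "f \<otimes>\<^bsub>End_monoid B\<^esub> g = compose (verts B) g f"
  by (simp add: End_monoid_def)

lemma End_one [simp]: "\<one>\<^bsub>End_monoid B\<^esub> = (\<lambda>x\<in>verts B. x)"
  by (simp add: End_monoid_def)

lemma End_verts: "f \<in> carrier (End_monoid B) \<Longrightarrow> w \<in> verts B \<Longrightarrow> f w \<in> verts B"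
  by (auto simp: End_carrier_iff homomorphism_def)

lemma End_edges: "f \<in> carrier (End_monoid B) \<Longrightarrow> (u, v) \<in> edges B \<Longrightarrow> (f u, f v) \<in> edges B"
  by (auto simp: End_carrier_iff homomorphism_def)

lemma End_same_part:
  "f \<in> carrier (End_monoid B) \<Longrightarrow> (u, v) \<in> same_part B \<Longrightarrow> (f u, f v) \<in> same_part B"
  by (auto simp: End_carrier_iff homomorphism_def)

lemma End_eqI:
  "f \<in> carrier (End_monoid B) \<Longrightarrow> g \<in> carrier (End_monoid B) \<Longrightarrow>
    (\<And>w. w \<in> verts B \<Longrightarrow> f w = g w) \<Longrightarrow> f = g"
  by (auto simp: End_carrier_iff intro: extensionalityI)

lemma monoid_End:
  assumes "is_structure B"
  shows "monoid (End_monoid B)"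
proof
  let ?M = "End_monoid B"
  show "f \<otimes>\<^bsub>?M\<^esub> g \<in> carrier ?M" if "f \<in> carrier ?M" "g \<in> carrier ?M" for f g
    using that assms
    by (auto simp: End_carrier_iff homomorphism_def is_structure_def compose_def)
  show "f \<otimes>\<^bsub>?M\<^esub> g \<otimes>\<^bsub>?M\<^esub> h = f \<otimes>\<^bsub>?M\<^esub> (g \<otimes>\<^bsub>?M\<^esub> h)"
    if "f \<in> carrier ?M" "g \<in> carrier ?M" "h \<in> carrier ?M" for f g h
    using that by (auto simp: compose_def End_verts)
  show "\<one>\<^bsub>?M\<^esub> \<in> carrier ?M"
    using assms by (auto simp: End_carrier_iff homomorphism_def is_structure_def)
  show "\<one>\<^bsub>?M\<^esub> \<otimes>\<^bsub>?M\<^esub> f = f" if "f \<in> carrier ?M" for f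
    using that by (auto simp: End_carrier_iff compose_def extensional_def)
  show "f \<otimes>\<^bsub>?M\<^esub> \<one>\<^bsub>?M\<^esub> = f" if "f \<in> carrier ?M" for f
    using that by (simp add: End_carrier_iff homomorphism_def Id_compose)
qed

section \<open>Endomorphisms representing a pair of relations\<close>

text \<open>Like \<open>same_part\<close>, the colour \<open>p\<close> enters only through equality
  of colours, so an isomorphism may exchange the two colours.\<close>

definition coloured_iso ::
    "'j set \<Rightarrow> ('j \<Rightarrow> bool) \<Rightarrow> ('j \<Rightarrow> 'j \<Rightarrow> bool) \<Rightarrow> ('j \<Rightarrow> 'j \<Rightarrow> bool) \<Rightarrow>
      ('j \<Rightarrow> 'j \<Rightarrow> bool) \<Rightarrow> ('j \<Rightarrow> 'j \<Rightarrow> bool) \<Rightarrow> ('j \<Rightarrow> 'j) \<Rightarrow> bool"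
  where "coloured_iso J p R1 R2 R1' R2' \<phi> \<longleftrightarrow> bij_betw \<phi> J J \<and>
    (\<forall>x\<in>J. \<forall>y\<in>J. (p (\<phi> x) = p (\<phi> y) \<longleftrightarrow> p x = p y) \<and>
      (R1' (\<phi> x) (\<phi> y) \<longleftrightarrow> R1 x y) \<and> (R2' (\<phi> x) (\<phi> y) \<longleftrightarrow> R2 x y))"

definition coloured_Aut ::
    "'j set \<Rightarrow> ('j \<Rightarrow> bool) \<Rightarrow> ('j \<Rightarrow> 'j \<Rightarrow> bool) \<Rightarrow> ('j \<Rightarrow> 'j \<Rightarrow> bool) \<Rightarrow> ('j \<Rightarrow> 'j) monoid"
  where "coloured_Aut J p R1 R2 =
    \<lparr>carrier = {\<tau> \<in> extensional J. coloured_iso J p R1 R2 R1 R2 \<tau>},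
     monoid.mult = (\<lambda>f g. compose J g f), one = (\<lambda>x\<in>J. x)\<rparr>"

lemma coloured_iso_inv:
  assumes "coloured_iso J p R1 R2 R1' R2' \<phi>"
  shows "coloured_iso J p R1' R2' R1 R2 (inv_into J \<phi>)"
proof -
  have b: "bij_betw \<phi> J J" using assms by (simp add: coloured_iso_def)
  have "bij_betw (inv_into J \<phi>) J J" using b by (rule bij_betw_inv_into)
  moreover have "inv_into J \<phi> x \<in> J" "\<phi> (inv_into J \<phi> x) = x" if "x \<in> J" for x
    using b that by (auto simp: bij_betw_inv_into_right bij_betw_def inv_into_into)
  ultimately show ?thesis using assms unfolding coloured_iso_def by metis
qed

text \<open>\<open>R2\<close> is the relation induced on the image of \<open>f\<close> and \<open>R1\<close> the set of images of edges
  under \<open>f\<close>. The last clause says that every automorphism of the resulting structure both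
  extends to an endomorphism \<open>t\<close> and lifts through \<open>f\<close> to an endomorphism \<open>a\<close>.\<close>

definition represents ::
    "'b bstruct \<Rightarrow> 'j set \<Rightarrow> ('j \<Rightarrow> bool) \<Rightarrow> ('j \<Rightarrow> 'j \<Rightarrow> bool) \<Rightarrow> ('j \<Rightarrow> 'j \<Rightarrow> bool) \<Rightarrow>
      ('b \<Rightarrow> 'b) \<Rightarrow> ('j \<Rightarrow> 'b) \<Rightarrow> bool"
  where "represents B J p R1 R2 f \<iota> \<longleftrightarrow>
    f \<in> carrier (End_monoid B) \<and> bij_betw \<iota> J (f ` verts B) \<and>
    (\<forall>x\<in>J. \<forall>y\<in>J. (\<iota> x, \<iota> y) \<in> same_part B \<longleftrightarrow> p x = p y) \<and>
    (\<forall>x\<in>J. \<forall>y\<in>J. (\<iota> x, \<iota> y) \<in> edges B \<longleftrightarrow> R2 x y) \<and>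
    (\<forall>x\<in>J. \<forall>y\<in>J. R1 x y \<longleftrightarrow> (\<exists>u v. (u, v) \<in> edges B \<and> f u = \<iota> x \<and> f v = \<iota> y)) \<and>
    (\<forall>\<tau>. coloured_iso J p R1 R2 R1 R2 \<tau> \<longrightarrow>
      (\<exists>t\<in>carrier (End_monoid B). \<exists>a\<in>carrier (End_monoid B).
        (\<forall>x\<in>J. t (\<iota> x) = \<iota> (\<tau> x)) \<and> (\<forall>w\<in>verts B. f (a w) = t (f w))))"

locale represented =
  fixes B :: "'b bstruct" and J :: "'j set" and p R1 R2 f \<iota>
  assumes str: "is_structure B" and rep: "represents B J p R1 R2 f \<iota>"
begin

abbreviation "M \<equiv> End_monoid B"
abbreviation "W \<equiv> verts B"

sublocale monoid M using str by (rule monoid_End)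

lemma f_End: "f \<in> carrier M" and \<iota>_bij: "bij_betw \<iota> J (f ` W)"
  and part_iff: "x \<in> J \<Longrightarrow> y \<in> J \<Longrightarrow> (\<iota> x, \<iota> y) \<in> same_part B \<longleftrightarrow> p x = p y"
  and R2_iff: "x \<in> J \<Longrightarrow> y \<in> J \<Longrightarrow> (\<iota> x, \<iota> y) \<in> edges B \<longleftrightarrow> R2 x y"
  and R1_iff: "x \<in> J \<Longrightarrow> y \<in> J \<Longrightarrow> R1 x y \<longleftrightarrow> (\<exists>u v. (u, v) \<in> edges B \<and> f u = \<iota> x \<and> f v = \<iota> y)"
  using rep unfolding represents_def by auto

lemma lift:
  assumes "coloured_iso J p R1 R2 R1 R2 \<tau>"
  obtains t a where "t \<in> carrier M" "a \<in> carrier M" "\<And>x. x \<in> J \<Longrightarrow> t (\<iota> x) = \<iota> (\<tau> x)"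
    "\<And>w. w \<in> W \<Longrightarrow> f (a w) = t (f w)"
proof -
  have "coloured_iso J p R1 R2 R1 R2 \<tau> \<longrightarrow>
      (\<exists>t\<in>carrier M. \<exists>a\<in>carrier M.
        (\<forall>x\<in>J. t (\<iota> x) = \<iota> (\<tau> x)) \<and> (\<forall>w\<in>W. f (a w) = t (f w)))"
    using rep unfolding represents_def by (elim conjE) (erule spec)
  from mp[OF this assms] show thesis using that by (elim bexE conjE) simp
qed

lemma edge_W: "(u, v) \<in> edges B \<Longrightarrow> u \<in> W \<and> v \<in> W"
  using str by (auto simp: is_structure_def)

lemma \<iota>_inj: "x \<in> J \<Longrightarrow> y \<in> J \<Longrightarrow> \<iota> x = \<iota> y \<longleftrightarrow> x = y"
  using \<iota>_bij by (auto simp: bij_betw_def inj_on_eq_iff)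

lemma f_im: "w \<in> W \<Longrightarrow> \<exists>x\<in>J. f w = \<iota> x"
  using \<iota>_bij by (metis bij_betw_imp_surj_on imageE imageI)

lemma \<iota>_im: "x \<in> J \<Longrightarrow> \<exists>w\<in>W. \<iota> x = f w"
  using \<iota>_bij by (metis bij_betw_imp_surj_on imageE imageI)

lemma \<iota>_W: "x \<in> J \<Longrightarrow> \<iota> x \<in> W"
  using \<iota>_im End_verts[OF f_End] by force

text \<open>Mutual left divisibility gives \<open>f\<close> and \<open>h\<close> the same image, and
  the multipliers carry edges over one pair of fibres to edges over the same pair. Hence the same
  \<open>\<iota>\<close> serves for \<open>h\<close>.\<close>

lemma Green_L_represents:
  assumes "(f, h) \<in> Green_L M"
  shows "represents B J p R1 R2 h \<iota>"
proof -
  obtain a b where a: "a \<in> carrier M" "h = a \<otimes>\<^bsub>M\<^esub> f" and b: "b \<in> carrier M" "f = b \<otimes>\<^bsub>M\<^esub> h"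
    and h: "h \<in> carrier M"
    using assms unfolding Green_L_iff by blast
  have ha: "h w = f (a w)" if "w \<in> W" for w using a(2) that by (simp add: compose_eq)
  have fb: "f w = h (b w)" if "w \<in> W" for w using b(2) that by (metis End_mult compose_eq)
  have "h ` W \<subseteq> f ` W" using ha End_verts[OF a(1)] by auto
  moreover have "f ` W \<subseteq> h ` W" using fb End_verts[OF b(1)] by auto
  ultimately have im: "h ` W = f ` W" by (rule equalityI)
  have "(\<exists>u v. (u, v) \<in> edges B \<and> f u = \<iota> x \<and> f v = \<iota> y) \<longleftrightarrow>
      (\<exists>u v. (u, v) \<in> edges B \<and> h u = \<iota> x \<and> h v = \<iota> y)" for x y
    using ha fb End_edges[OF a(1)] End_edges[OF b(1)] edge_W by metis
  moreover have "\<exists>t\<in>carrier M. \<exists>c\<in>carrier M.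
      (\<forall>x\<in>J. t (\<iota> x) = \<iota> (\<tau> x)) \<and> (\<forall>w\<in>W. h (c w) = t (h w))"
    if \<tau>: "coloured_iso J p R1 R2 R1 R2 \<tau>" for \<tau>
  proof -
    obtain t c where t: "t \<in> carrier M" "c \<in> carrier M" "\<And>x. x \<in> J \<Longrightarrow> t (\<iota> x) = \<iota> (\<tau> x)"
      "\<And>w. w \<in> W \<Longrightarrow> f (c w) = t (f w)"
      using lift[OF \<tau>] by blast
    \<comment> \<open>The lift through \<open>h\<close>: pass to \<open>f\<close> by
      \<open>a\<close>, lift there by \<open>c\<close>, return by \<open>b\<close>.\<close>
    let ?d = "a \<otimes>\<^bsub>M\<^esub> c \<otimes>\<^bsub>M\<^esub> b"
    have "h (?d w) = t (h w)" if w: "w \<in> W" for w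
    proof -
      have aw: "a w \<in> W" "c (a w) \<in> W" 
        using End_verts[OF a(1) w] End_verts[OF t(2) End_verts[OF a(1) w]] .
      have "h (?d w) = h (b (c (a w)))" using w by (simp add: compose_eq)
      also have "\<dots> = f (c (a w))" using fb[OF aw(2)] by simp
      also have "\<dots> = t (h w)" using t(4)[OF aw(1)] ha[OF w] by simp
      finally show ?thesis .
    qed
    moreover have "?d \<in> carrier M" using a(1) b(1) t(2) by (simp del: End_mult)
    ultimately show ?thesis using t by blast
  qed
  ultimately show ?thesis
    using rep h im unfolding represents_def by simp
qed

text \<open>The multipliers \<open>x\<close> and \<open>y\<close> are mutually inverse between the
  images of \<open>f\<close> and \<open>g\<close>, and both maps have the same fibres. The labelling
  is moved along \<open>x\<close>; lifts stay the same and extensions are conjugated.\<close>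

lemma Green_R_represents:
  assumes "(f, g) \<in> Green_R M"
  shows "\<exists>\<kappa>. represents B J p R1 R2 g \<kappa>"
proof -
  obtain x y where x: "x \<in> carrier M" "g = f \<otimes>\<^bsub>M\<^esub> x" and y: "y \<in> carrier M" "f = g \<otimes>\<^bsub>M\<^esub> y"
    and g: "g \<in> carrier M"
    using assms unfolding Green_R_iff by blast
  have gx: "g w = x (f w)" if "w \<in> W" for w using x(2) that by (simp add: compose_eq)
  have fy: "f w = y (g w)" if "w \<in> W" for w using y(2) that by (metis End_mult compose_eq)
  define \<kappa> where "\<kappa> = x \<circ> \<iota>"
  have y\<kappa>: "y (\<kappa> z) = \<iota> z" if "z \<in> J" for z
    using \<iota>_im[OF that] gx fy unfolding \<kappa>_def by (metis comp_apply)
  have fg: "f w = \<iota> z \<longleftrightarrow> g w = \<kappa> z" if "w \<in> W" "z \<in> J" for w z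
    using that gx fy y\<kappa> unfolding \<kappa>_def by (metis comp_apply)
  have "bij_betw \<kappa> J (g ` W)"
    unfolding bij_betw_def
  proof
    show "inj_on \<kappa> J" using y\<kappa> \<iota>_inj by (metis inj_onI)
    show "\<kappa> ` J = g ` W"
    proof
      show "\<kappa> ` J \<subseteq> g ` W" using fg \<iota>_im by (metis imageI image_subsetI)
      show "g ` W \<subseteq> \<kappa> ` J" using fg f_im by (metis imageI image_subsetI)
    qed
  qed
  moreover have "(\<kappa> z, \<kappa> z') \<in> same_part B \<longleftrightarrow> p z = p z'" if "z \<in> J" "z' \<in> J" for z z'
    using part_iff[OF that] End_same_part[OF x(1)] End_same_part[OF y(1)] y\<kappa> that
    unfolding \<kappa>_def by (metis comp_apply)
  moreover have "(\<kappa> z, \<kappa> z') \<in> edges B \<longleftrightarrow> R2 z z'" if "z \<in> J" "z' \<in> J" for z z'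
    using R2_iff[OF that] End_edges[OF x(1)] End_edges[OF y(1)] y\<kappa> that
    unfolding \<kappa>_def by (metis comp_apply)
  moreover have "R1 z z' \<longleftrightarrow> (\<exists>u v. (u, v) \<in> edges B \<and> g u = \<kappa> z \<and> g v = \<kappa> z')"
    if "z \<in> J" "z' \<in> J" for z z'
    using R1_iff[OF that] fg edge_W that by meson
  moreover have "\<exists>t\<in>carrier M. \<exists>c\<in>carrier M.
      (\<forall>z\<in>J. t (\<kappa> z) = \<kappa> (\<tau> z)) \<and> (\<forall>w\<in>W. g (c w) = t (g w))"
    if \<tau>: "coloured_iso J p R1 R2 R1 R2 \<tau>" for \<tau>
  proof -
    obtain t c where t: "t \<in> carrier M" "c \<in> carrier M" "\<And>x. x \<in> J \<Longrightarrow> t (\<iota> x) = \<iota> (\<tau> x)"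
      "\<And>w. w \<in> W \<Longrightarrow> f (c w) = t (f w)"
      using lift[OF \<tau>] by blast
    let ?s = "y \<otimes>\<^bsub>M\<^esub> t \<otimes>\<^bsub>M\<^esub> x"
    have s: "?s w = x (t (y w))" if "w \<in> W" for w using that by (simp add: compose_eq)
    have "?s (\<kappa> z) = \<kappa> (\<tau> z)" if "z \<in> J" for z
      using s[of "\<kappa> z"] that y\<kappa> t(3) End_verts[OF x(1) \<iota>_W] unfolding \<kappa>_def by simp
    moreover have "g (c w) = ?s (g w)" if w: "w \<in> W" for w
    proof -
      have "g (c w) = x (f (c w))" using gx[OF End_verts[OF t(2) w]] .
      also have "\<dots> = x (t (y (g w)))" using t(4)[OF w] fy[OF w] by simp
      also have "\<dots> = ?s (g w)" using s[OF End_verts[OF g w]] by simp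
      finally show ?thesis .
    qed
    moreover have "?s \<in> carrier M" using x(1) y(1) t(1) by (simp del: End_mult)
    ultimately show ?thesis using t by blast
  qed
  ultimately show ?thesis using g unfolding represents_def by blast
qed

text \<open>A generalized inverse of \<open>f\<close> would send induced edges to edges and \<open>f\<close> would send these
  back, so that \<open>R2\<close> would be contained in \<open>R1\<close>.\<close>

lemma not_regular:
  assumes "x \<in> J" "y \<in> J" "R2 x y" "\<not> R1 x y"
  shows "\<not> regular_element M f"
proof
  assume "regular_element M f"
  then obtain g where g: "g \<in> carrier M" "f \<otimes>\<^bsub>M\<^esub> g \<otimes>\<^bsub>M\<^esub> f = f"
    unfolding regular_element_def by blast
  have fg: "f (g (f w)) = f w" if "w \<in> W" for w
    using fun_cong[OF g(2), of w] that by (simp add: compose_eq)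
  have "f (g (\<iota> z)) = \<iota> z" if "z \<in> J" for z
    using \<iota>_im[OF that] fg by auto
  moreover have "(g (\<iota> x), g (\<iota> y)) \<in> edges B"
    using R2_iff assms End_edges[OF g(1)] by blast
  ultimately have "R1 x y" using R1_iff assms by blast
  then show False using assms by blast
qed

text \<open>Both representations label the same image of \<open>f\<close>, so going out along
  \<open>\<iota>\<close> and back along \<open>\<kappa>\<close> compares them. This is what tells
  D-classes apart.\<close>

lemma represents_unique:
  assumes "represents B J p R1' R2' f \<kappa>"
  shows "\<exists>\<phi>. coloured_iso J p R1 R2 R1' R2' \<phi>"
proof -
  interpret r2: represented B J p R1' R2' f \<kappa>
    using str assms by unfold_locales
  define \<phi> where "\<phi> = inv_into J \<kappa> \<circ> \<iota>"
  have \<phi>: "bij_betw \<phi> J J"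
    unfolding \<phi>_def using \<iota>_bij bij_betw_inv_into[OF r2.\<iota>_bij] by (rule bij_betw_trans)
  have \<kappa>\<phi>: "\<kappa> (\<phi> x) = \<iota> x" if "x \<in> J" for x
    unfolding \<phi>_def using r2.\<iota>_bij \<iota>_bij that
    by (metis bij_betw_apply bij_betw_inv_into_right comp_apply)
  have \<phi>J: "\<phi> x \<in> J" if "x \<in> J" for x using \<phi> that by (auto simp: bij_betw_def)
  have "(p (\<phi> x) = p (\<phi> y) \<longleftrightarrow> p x = p y) \<and>
      (R1' (\<phi> x) (\<phi> y) \<longleftrightarrow> R1 x y) \<and> (R2' (\<phi> x) (\<phi> y) \<longleftrightarrow> R2 x y)" if "x \<in> J" "y \<in> J" for x y
    using part_iff[OF that] R1_iff[OF that] R2_iff[OF that] \<phi>J that \<kappa>\<phi>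
      r2.part_iff[of "\<phi> x" "\<phi> y"] r2.R1_iff[of "\<phi> x" "\<phi> y"] r2.R2_iff[of "\<phi> x" "\<phi> y"] by simp
  then show ?thesis using \<phi> unfolding coloured_iso_def by blast
qed

section \<open>The Schuetzenberger group as an automorphism group\<close>

definition "H = Green_H M `` {f}"

text \<open>Moves the values of \<open>h\<close> by \<open>\<tau>\<close>, transported along
  \<open>\<iota>\<close>. The formula involves no chosen extension of \<open>\<tau>\<close> to an
  endomorphism.\<close>

abbreviation "T \<tau> \<equiv> (\<lambda>h\<in>H. compose W (\<lambda>w. \<iota> (\<tau> (inv_into J \<iota> w))) h)"

lemma H_im:
  assumes "h \<in> H" "w \<in> W"
  obtains x where "x \<in> J" "h w = \<iota> x"
proof -
  have "(f, h) \<in> Green_L M" using assms(1) by (auto simp: H_def Green_H_def)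
  then obtain a where a: "a \<in> carrier M" "h = a \<otimes>\<^bsub>M\<^esub> f" unfolding Green_L_iff by blast
  then have "h w = f (a w)" using assms(2) by (simp add: compose_eq)
  then show thesis using f_im[of "a w"] End_verts[OF a(1) assms(2)] that by auto
qed

lemma f_H: "f \<in> H"
  using Green_H_refl[OF f_End] by (simp add: H_def)

text \<open>Members of \<open>H\<close> take their values in the image of \<open>f\<close>, so only
  the effect of \<open>t\<close> there matters.\<close>

lemma T_eq:
  assumes "\<And>x. x \<in> J \<Longrightarrow> t (\<iota> x) = \<iota> (\<tau> x)"
  shows "T \<tau> = (\<lambda>h\<in>H. h \<otimes>\<^bsub>M\<^esub> t)"
proof (rule restrict_ext)
  fix h assume h: "h \<in> H"
  show "compose W (\<lambda>w. \<iota> (\<tau> (inv_into J \<iota> w))) h = h \<otimes>\<^bsub>M\<^esub> t"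
  proof
    fix w
    show "compose W (\<lambda>w. \<iota> (\<tau> (inv_into J \<iota> w))) h w = (h \<otimes>\<^bsub>M\<^esub> t) w"
    proof (cases "w \<in> W")
      case True
      obtain x where x: "x \<in> J" "h w = \<iota> x" using H_im[OF h True] .
      then have "inv_into J \<iota> (h w) = x"
        using \<iota>_bij by (simp add: bij_betw_inv_into_left)
      then show ?thesis using True x assms by (simp add: compose_eq)
    qed (simp add: compose_def)
  qed
qed

text \<open>The lift \<open>a\<close> gives \<open>f \<otimes> t = a \<otimes> f\<close>. Extension
  and lift of the inverse automorphism give \<open>f\<close> back from \<open>f \<otimes> t\<close>
  on either side, so the two are H-related, and this spreads from \<open>f\<close> to the whole
  class.\<close>

lemma T_in_Schuetzenberger:
  assumes \<tau>: "coloured_iso J p R1 R2 R1 R2 \<tau>"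
  shows "T \<tau> \<in> carrier (Schuetzenberger_group M H)" and "h \<in> H \<Longrightarrow> T \<tau> h \<in> H"
proof -
  let ?\<sigma> = "inv_into J \<tau>"
  have \<sigma>: "coloured_iso J p R1 R2 R1 R2 ?\<sigma>" using \<tau> by (rule coloured_iso_inv)
  have b: "bij_betw \<tau> J J" using \<tau> by (simp add: coloured_iso_def)
  obtain t a where t: "t \<in> carrier M" "a \<in> carrier M" "\<And>x. x \<in> J \<Longrightarrow> t (\<iota> x) = \<iota> (\<tau> x)"
      "\<And>w. w \<in> W \<Longrightarrow> f (a w) = t (f w)"
    using lift[OF \<tau>] by blast
  obtain s c where s: "s \<in> carrier M" "c \<in> carrier M" "\<And>x. x \<in> J \<Longrightarrow> s (\<iota> x) = \<iota> (?\<sigma> x)"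
      "\<And>w. w \<in> W \<Longrightarrow> f (c w) = s (f w)"
    using lift[OF \<sigma>] by blast
  have J: "\<tau> x \<in> J" "?\<sigma> x \<in> J" "?\<sigma> (\<tau> x) = x" "\<tau> (?\<sigma> x) = x" if "x \<in> J" for x
    using b that by (auto simp: bij_betw_inv_into_left bij_betw_inv_into_right
        bij_betw_def inv_into_into)
  have ts: "s (t (f w)) = f w" "t (s (f w)) = f w" if "w \<in> W" for w
    using f_im[OF that] J t(3) s(3) by auto
  have ft: "f \<otimes>\<^bsub>M\<^esub> t \<in> carrier M" using f_End t by (simp del: End_mult)
  have "f \<otimes>\<^bsub>M\<^esub> t = a \<otimes>\<^bsub>M\<^esub> f"
  proof (rule End_eqI[OF ft m_closed[OF t(2) f_End]])
    show "(f \<otimes>\<^bsub>M\<^esub> t) w = (a \<otimes>\<^bsub>M\<^esub> f) w" if "w \<in> W" for w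
      using that t(4) by (simp add: compose_eq)
  qed
  moreover have "f = c \<otimes>\<^bsub>M\<^esub> (f \<otimes>\<^bsub>M\<^esub> t)"
  proof (rule End_eqI[OF f_End m_closed[OF s(2) ft]])
    show "f w = (c \<otimes>\<^bsub>M\<^esub> (f \<otimes>\<^bsub>M\<^esub> t)) w" if "w \<in> W" for w
      using that ts(2) s(4) End_verts[OF s(2)] by (simp add: compose_eq)
  qed
  moreover have "f = f \<otimes>\<^bsub>M\<^esub> t \<otimes>\<^bsub>M\<^esub> s"
  proof (rule End_eqI[OF f_End m_closed[OF ft s(1)]])
    show "f w = (f \<otimes>\<^bsub>M\<^esub> t \<otimes>\<^bsub>M\<^esub> s) w" if "w \<in> W" for w
      using that ts(1) by (simp add: compose_eq)
  qed
  ultimately have "(f, f \<otimes>\<^bsub>M\<^esub> t) \<in> Green_H M"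
    unfolding Green_H_def Int_iff Green_L_iff Green_R_iff
    using f_End ft t(1,2) s(1,2) by blast
  then have Ht: "h \<otimes>\<^bsub>M\<^esub> t \<in> H" if "h \<in> H" for h
    using that Green_H_class_stable[OF t(1)] by (simp add: H_def del: End_mult)
  then show "h \<in> H \<Longrightarrow> T \<tau> h \<in> H"
    using T_eq[of t \<tau>] t(3) by simp
  have "H #>\<^bsub>M\<^esub> t \<subseteq> H" using Ht by (auto simp: r_coset_def)
  then show "T \<tau> \<in> carrier (Schuetzenberger_group M H)"
    using t(1,3) T_eq[of t \<tau>] by (auto simp: Schuetzenberger_group_def)
qed

text \<open>On the image of \<open>f\<close> the map \<open>t\<close> is a permutation:
  R-relatedness provides an \<open>s\<close> undoing it, L-relatedness provides preimages through
  \<open>b\<close>. Parts and \<open>R2\<close> are respected because \<open>t\<close> and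
  \<open>s\<close> are endomorphisms; for \<open>R1\<close> the edges are carried upstairs by
  \<open>a\<close> and \<open>b\<close>.\<close>

lemma Schuetzenberger_eq_T:
  assumes "\<gamma> \<in> carrier (Schuetzenberger_group M H)"
  shows "\<exists>\<tau> \<in> carrier (coloured_Aut J p R1 R2). \<gamma> = T \<tau>"
proof -
  obtain t where t: "t \<in> carrier M" "H #>\<^bsub>M\<^esub> t \<subseteq> H" "\<gamma> = (\<lambda>h\<in>H. h \<otimes>\<^bsub>M\<^esub> t)"
    using assms by (auto simp: Schuetzenberger_group_def)
  have "f \<otimes>\<^bsub>M\<^esub> t \<in> H" using t(2) f_H by (auto simp: r_coset_def)
  then have L: "(f, f \<otimes>\<^bsub>M\<^esub> t) \<in> Green_L M" and R: "(f, f \<otimes>\<^bsub>M\<^esub> t) \<in> Green_R M"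
    by (auto simp: H_def Green_H_def)
  obtain a b where a: "a \<in> carrier M" "f \<otimes>\<^bsub>M\<^esub> t = a \<otimes>\<^bsub>M\<^esub> f"
    and b: "b \<in> carrier M" "f = b \<otimes>\<^bsub>M\<^esub> (f \<otimes>\<^bsub>M\<^esub> t)"
    using L unfolding Green_L_iff by blast
  obtain s where s: "s \<in> carrier M" "f = f \<otimes>\<^bsub>M\<^esub> t \<otimes>\<^bsub>M\<^esub> s"
    using R unfolding Green_R_iff by blast
  have fa: "t (f w) = f (a w)" if "w \<in> W" for w
    using fun_cong[OF a(2), of w] that by (simp add: compose_eq)
  have fb: "f w = t (f (b w))" if "w \<in> W" for w
    using fun_cong[OF b(2), of w] that End_verts[OF b(1)] by (simp add: compose_eq)
  have fs: "s (t (f w)) = f w" if "w \<in> W" for w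
    using fun_cong[OF s(2), of w] that by (simp add: compose_eq)
  define \<tau> where "\<tau> = (\<lambda>x\<in>J. inv_into J \<iota> (t (\<iota> x)))"
  have \<iota>\<tau>: "\<tau> x \<in> J \<and> \<iota> (\<tau> x) = t (\<iota> x)" if x: "x \<in> J" for x
  proof -
    obtain w where w: "w \<in> W" "\<iota> x = f w" using \<iota>_im[OF x] by blast
    then have "t (\<iota> x) \<in> f ` W" using fa End_verts[OF a(1)] by simp
    then have "t (\<iota> x) \<in> \<iota> ` J" using \<iota>_bij by (simp add: bij_betw_def)
    then show ?thesis unfolding \<tau>_def using x by (simp add: inv_into_into f_inv_into_f)
  qed
  have st: "s (t (\<iota> x)) = \<iota> x" if "x \<in> J" for x
    using \<iota>_im[OF that] fs by auto
  have "bij_betw \<tau> J J"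
    unfolding bij_betw_def
  proof
    show "inj_on \<tau> J" using \<iota>\<tau> st \<iota>_inj by (metis inj_onI)
    show "\<tau> ` J = J"
    proof
      show "\<tau> ` J \<subseteq> J" using \<iota>\<tau> by blast
      show "J \<subseteq> \<tau> ` J"
      proof
        fix y assume y: "y \<in> J"
        obtain w where w: "w \<in> W" "\<iota> y = f w" using \<iota>_im[OF y] by blast
        obtain x where x: "x \<in> J" "f (b w) = \<iota> x" using f_im[OF End_verts[OF b(1) w(1)]] by blast
        then have "\<iota> (\<tau> x) = \<iota> y" using \<iota>\<tau> fb[OF w(1)] w by simp
        then have "\<tau> x = y" using \<iota>\<tau> x y \<iota>_inj by blast
        then show "y \<in> \<tau> ` J" using x by blast
      qed
    qed
  qed
  moreover have "(p (\<tau> x) = p (\<tau> y) \<longleftrightarrow> p x = p y) \<and>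
      (R1 (\<tau> x) (\<tau> y) \<longleftrightarrow> R1 x y) \<and> (R2 (\<tau> x) (\<tau> y) \<longleftrightarrow> R2 x y)" if xy: "x \<in> J" "y \<in> J" for x y
  proof (intro conjI)
    show "p (\<tau> x) = p (\<tau> y) \<longleftrightarrow> p x = p y"
      using part_iff xy \<iota>\<tau> st End_same_part[OF t(1)] End_same_part[OF s(1)] by metis
    show "R2 (\<tau> x) (\<tau> y) \<longleftrightarrow> R2 x y"
      using R2_iff xy \<iota>\<tau> st End_edges[OF t(1)] End_edges[OF s(1)] by metis
    show "R1 (\<tau> x) (\<tau> y) \<longleftrightarrow> R1 x y"
    proof
      assume "R1 x y"
      then obtain u v where "(u, v) \<in> edges B" "f u = \<iota> x" "f v = \<iota> y"
        using R1_iff xy by blast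
      then have "(a u, a v) \<in> edges B" "f (a u) = \<iota> (\<tau> x)" "f (a v) = \<iota> (\<tau> y)"
        using End_edges[OF a(1)] fa \<iota>\<tau> xy edge_W by metis+
      then show "R1 (\<tau> x) (\<tau> y)" using R1_iff xy \<iota>\<tau> by blast
    next
      assume "R1 (\<tau> x) (\<tau> y)"
      then obtain u v where uv: "(u, v) \<in> edges B" "f u = \<iota> (\<tau> x)" "f v = \<iota> (\<tau> y)"
        using R1_iff xy \<iota>\<tau> by blast
      \<comment> \<open>\<open>b\<close> lifts the inverse of \<open>\<tau>\<close>: it is a section
        for \<open>t\<close> on values, and \<open>s\<close> cancels \<open>t\<close>.\<close>
      have *: "f (b w) = \<iota> z" if "w \<in> W" "z \<in> J" "f w = \<iota> (\<tau> z)" for w z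
        using that fb fs[OF End_verts[OF b(1)]] \<iota>\<tau> st by metis
      have "(b u, b v) \<in> edges B" "f (b u) = \<iota> x" "f (b v) = \<iota> y"
        using End_edges[OF b(1)] uv * edge_W xy by blast+
      then show "R1 x y" using R1_iff xy by blast
    qed
  qed
  ultimately have "\<tau> \<in> carrier (coloured_Aut J p R1 R2)"
    unfolding coloured_Aut_def coloured_iso_def by (simp add: \<tau>_def)
  moreover have "\<gamma> = T \<tau>" unfolding t(3) using T_eq[of t \<tau>] \<iota>\<tau> by simp
  ultimately show ?thesis by blast
qed

text \<open>\<open>T\<close> is the isomorphism. It is injective because \<open>f\<close> itself
  lies in \<open>H\<close> and its values exhaust the labelled image; both products apply the left
  factor first.\<close>

lemma Schuetzenberger_iso: "coloured_Aut J p R1 R2 \<cong> Schuetzenberger_group M H"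
proof -
  let ?A = "coloured_Aut J p R1 R2" and ?S = "Schuetzenberger_group M H"
  have A: "\<tau> \<in> carrier ?A \<longleftrightarrow> \<tau> \<in> extensional J \<and> coloured_iso J p R1 R2 R1 R2 \<tau>" for \<tau>
    by (auto simp: coloured_Aut_def)
  have inj: "inj_on T (carrier ?A)"
  proof (rule inj_onI)
    fix \<tau> \<sigma> assume \<tau>: "\<tau> \<in> carrier ?A" and \<sigma>: "\<sigma> \<in> carrier ?A" and eq: "T \<tau> = T \<sigma>"
    have J: "\<tau> x \<in> J" "\<sigma> x \<in> J" if "x \<in> J" for x
      using \<tau> \<sigma> that by (auto simp: A coloured_iso_def bij_betw_def)
    have "\<tau> x = \<sigma> x" if x: "x \<in> J" for x
    proof -
      obtain w where w: "w \<in> W" "\<iota> x = f w" using \<iota>_im[OF x] by blast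
      have "inv_into J \<iota> (f w) = x"
        using \<iota>_bij x w(2) by (metis bij_betw_inv_into_left)
      moreover have "T \<tau> f w = T \<sigma> f w" using eq by simp
      ultimately show ?thesis using f_H w(1) \<iota>_inj J[OF x] by (simp add: compose_eq)
    qed
    then show "\<tau> = \<sigma>" using \<tau> \<sigma> by (auto simp: A intro: extensionalityI)
  qed
  have T_S: "T \<tau> \<in> carrier ?S" if "\<tau> \<in> carrier ?A" for \<tau>
    using that T_in_Schuetzenberger(1) by (simp add: A)
  have "T ` carrier ?A = carrier ?S"
    using T_S Schuetzenberger_eq_T by blast
  moreover have "T (\<tau> \<otimes>\<^bsub>?A\<^esub> \<sigma>) = T \<tau> \<otimes>\<^bsub>?S\<^esub> T \<sigma>"
    if \<tau>: "\<tau> \<in> carrier ?A" and \<sigma>: "\<sigma> \<in> carrier ?A" for \<tau> \<sigma>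
  proof
    fix h
    show "T (\<tau> \<otimes>\<^bsub>?A\<^esub> \<sigma>) h = (T \<tau> \<otimes>\<^bsub>?S\<^esub> T \<sigma>) h"
    proof (cases "h \<in> H")
      case True
      have Th: "T \<tau> h \<in> H" using T_in_Schuetzenberger(2) \<tau> True by (simp add: A)
      have "T (\<tau> \<otimes>\<^bsub>?A\<^esub> \<sigma>) h w = T \<sigma> (T \<tau> h) w" for w
      proof (cases "w \<in> W")
        case w: True
        obtain x where x: "x \<in> J" "h w = \<iota> x" using H_im[OF True w] .
        have "\<tau> x \<in> J" using \<tau> x by (auto simp: A coloured_iso_def bij_betw_def)
        moreover have "inv_into J \<iota> (\<iota> z) = z" if "z \<in> J" for z
          using \<iota>_bij that by (simp add: bij_betw_inv_into_left)
        ultimately show ?thesis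
          using x w True Th by (simp add: compose_eq coloured_Aut_def)
      next
        case False
        then show ?thesis using True Th by (simp add: compose_def)
      qed
      then have "T (\<tau> \<otimes>\<^bsub>?A\<^esub> \<sigma>) h = T \<sigma> (T \<tau> h)" by blast
      then show ?thesis using True by (simp add: Schuetzenberger_group_def compose_eq)
    qed (simp add: Schuetzenberger_group_def compose_def)
  qed
  ultimately have "T \<in> iso ?A ?S"
    using inj T_S by (auto simp: iso_def hom_def bij_betw_def)
  then show ?thesis by (auto simp: is_iso_def)
qed

end

section \<open>Realising a pair of relations by an endomorphism\<close>

context generic_bipartite
begin

lemma is_structure_B: "is_structure B"
  using edge_verts same_part_iff by (auto simp: is_structure_def)

text \<open>A finite vertex set could be taken as the set \<open>N\<close> to avoid, and the
  extension property would give a vertex outside of it.\<close>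

lemma infinite_verts: "infinite (verts B)"
proof
  assume "finite (verts B)"
  then show False using extension[of "{}" "verts B" undefined] by simp
qed

definition "b = from_nat_into (verts B)"

lemma b_verts: "b n \<in> verts B"
  unfolding b_def using infinite_verts by (intro from_nat_into) auto

lemma b_surj: "w \<in> verts B \<Longrightarrow> \<exists>n. b n = w"
  unfolding b_def by (rule from_nat_into_surj[OF countable_verts])

lemma b_inj: "inj b"
  unfolding b_def inj_def using countable_verts infinite_verts by simp

lemma edge_irrefl: "(u, u) \<notin> edges B"
  using edge_parts by blast

text \<open>Values are chosen along the enumeration \<open>b\<close>, going forth only.
  \<open>Q w r\<close> says that \<open>r\<close> is admissible for \<open>w\<close>;
  \<open>F\<close> stands for the earlier neighbours of \<open>w\<close> with their values, of which
  there are finitely many at each stage.\<close>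

lemma End_from_choices:
  assumes part: "\<And>w r. w \<in> verts B \<Longrightarrow> r \<in> verts B \<Longrightarrow> Q w r \<Longrightarrow> q r = q w"
    and step: "\<And>w F. w \<in> verts B \<Longrightarrow> finite F \<Longrightarrow>
      (\<And>u r. (u, r) \<in> F \<Longrightarrow> u \<in> verts B \<and> r \<in> verts B \<and> (w, u) \<in> edges B \<and> Q u r) \<Longrightarrow>
      \<exists>r\<in>verts B. Q w r \<and> (\<forall>(u, r')\<in>F. (r, r') \<in> edges B)"
  shows "\<exists>t\<in>carrier (End_monoid B). \<forall>w\<in>verts B. Q w (t w)"
proof -
  define P where "P \<alpha> n r \<longleftrightarrow> r \<in> verts B \<and> Q (b n) r \<and>
    (\<forall>m<n. (b n, b m) \<in> edges B \<longrightarrow> (r, \<alpha> m) \<in> edges B)" for \<alpha> :: "nat \<Rightarrow> 'b" and n r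
  have "\<exists>\<alpha>. \<forall>n. P \<alpha> n (\<alpha> n)"
  proof (rule dependent_wellorder_choice)
    show "P f n r = P g n r" if "\<And>m. m < n \<Longrightarrow> f m = g m" for r f g n
      using that unfolding P_def by auto
    fix n \<alpha> assume IH: "\<And>m. m < n \<Longrightarrow> P \<alpha> m (\<alpha> m)"
    let ?F = "(\<lambda>m. (b m, \<alpha> m)) ` {m. m < n \<and> (b n, b m) \<in> edges B}"
    have "\<exists>r\<in>verts B. Q (b n) r \<and> (\<forall>(u, r')\<in>?F. (r, r') \<in> edges B)"
      by (rule step) (use IH b_verts in \<open>auto simp: P_def\<close>)
    then show "\<exists>r. P \<alpha> n r" unfolding P_def by fastforce
  qed
  then obtain \<alpha> where \<alpha>: "\<And>n. P \<alpha> n (\<alpha> n)" by blast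
  define t where "t = (\<lambda>w\<in>verts B. \<alpha> (inv_into UNIV b w))"
  have tb: "t (b n) = \<alpha> n" for n
    unfolding t_def using b_verts b_inj by (simp add: inv_f_f)
  have t_verts: "t (b n) \<in> verts B" and t_Q: "Q (b n) (t (b n))" for n
    using \<alpha>[of n] by (auto simp: P_def tb)
  have "(t (b m), t (b n)) \<in> edges B" if e: "(b m, b n) \<in> edges B" for m n
  proof (cases m n rule: linorder_cases)
    case less
    then show ?thesis using \<alpha>[of n] e edge_sym by (auto simp: P_def tb)
  next
    case equal
    then show ?thesis using e edge_irrefl by simp
  next
    case greater
    then show ?thesis using \<alpha>[of m] e by (auto simp: P_def tb)
  qed
  then have "(t u, t v) \<in> edges B" if "(u, v) \<in> edges B" for u v
    using that edge_verts b_surj by metis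
  moreover have tW: "t w \<in> verts B" "Q w (t w)" if "w \<in> verts B" for w
    using b_surj[OF that] t_verts t_Q by auto
  moreover have "(t u, t v) \<in> same_part B" if "(u, v) \<in> same_part B" for u v
    using that tW part unfolding same_part_iff by metis
  ultimately have "t \<in> carrier (End_monoid B)"
    by (auto simp: End_carrier_iff homomorphism_def t_def)
  then show ?thesis using tW by blast
qed

lemma End_extending:
  assumes X: "X \<subseteq> verts B" and fin: "\<And>w. w \<in> verts B - X \<Longrightarrow> finite {x\<in>X. (w, x) \<in> edges B}"
    and g: "\<And>x. x \<in> X \<Longrightarrow> g x \<in> verts B \<and> q (g x) = q x"
    and g_edges: "\<And>x y. x \<in> X \<Longrightarrow> y \<in> X \<Longrightarrow> (x, y) \<in> edges B \<Longrightarrow> (g x, g y) \<in> edges B"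
  shows "\<exists>t\<in>carrier (End_monoid B). \<forall>x\<in>X. t x = g x"
proof -
  \<comment> \<open>Outside \<open>X\<close> the value must be adjacent to the prescribed values of
    all neighbours in \<open>X\<close>, including those met later. By sparseness these are finitely
    many conditions.\<close>
  define Q where "Q w r \<longleftrightarrow> (if w \<in> X then r = g w else
    q r = q w \<and> (\<forall>x\<in>X. (w, x) \<in> edges B \<longrightarrow> (r, g x) \<in> edges B))" for w r
  have "\<exists>t\<in>carrier (End_monoid B). \<forall>w\<in>verts B. Q w (t w)"
  proof (rule End_from_choices)
    show "q r = q w" if "Q w r" for w r
      using that g unfolding Q_def by (metis (full_types))
    fix w F assume w: "w \<in> verts B" and F: "finite F"
      and FQ: "\<And>u r. (u, r) \<in> F \<Longrightarrow> u \<in> verts B \<and> r \<in> verts B \<and> (w, u) \<in> edges B \<and> Q u r"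
    show "\<exists>r\<in>verts B. Q w r \<and> (\<forall>(u, r')\<in>F. (r, r') \<in> edges B)"
    proof (cases "w \<in> X")
      case True
      have "(g w, r') \<in> edges B" if "(u, r') \<in> F" for u r'
        using FQ[OF that] True g_edges edge_sym unfolding Q_def by metis
      then show ?thesis using True g[OF True] unfolding Q_def by auto
    next
      case False
      let ?U = "snd ` F \<union> g ` {x\<in>X. (w, x) \<in> edges B}"
      have "q u = (\<not> q w)" if u: "u \<in> ?U" for u
        using u
      proof
        assume "u \<in> snd ` F"
        then obtain v where "(v, u) \<in> F" by auto
        from FQ[OF this] have "q u = q v" "q w \<noteq> q v"
          using g edge_parts unfolding Q_def by metis+
        then show ?thesis by auto
      next
        assume "u \<in> g ` {x\<in>X. (w, x) \<in> edges B}"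
        then obtain x where "x \<in> X" "u = g x" "(w, x) \<in> edges B" by auto
        then show ?thesis using g edge_parts by metis
      qed
      moreover have "finite ?U" using F fin w False by auto
      moreover have "?U \<subseteq> verts B" using FQ g by auto
      ultimately obtain v where "v \<in> verts B" "q v = q w" "\<forall>u\<in>?U. (v, u) \<in> edges B"
        using extension[of ?U "{}" "\<not> q w"] by auto
      then show ?thesis using False unfolding Q_def by force
    qed
  qed
  then show ?thesis using X unfolding Q_def by (metis subsetD)
qed

end

text \<open>\<open>common_neighbour\<close> lets a homomorphism into \<open>R1\<close> be continued
  by one more vertex. \<open>Aut_parts\<close> matches the construction of extensions and lifts,
  which keeps \<open>q\<close> fixed.\<close>

locale coloured_target =
  fixes J :: "'j set" and p :: "'j \<Rightarrow> bool" and R1 R2 :: "'j \<Rightarrow> 'j \<Rightarrow> bool"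
  assumes countable_J: "countable J" and infinite_J: "infinite J"
    and R1_R2: "R1 x y \<Longrightarrow> R2 x y"
    and R1_sym: "R1 x y \<Longrightarrow> R1 y x" and R2_sym: "R2 x y \<Longrightarrow> R2 y x"
    and R2_parts: "R2 x y \<Longrightarrow> p x \<noteq> p y"
    and common_neighbour: "\<lbrakk>finite F; F \<subseteq> J; \<forall>x\<in>F. p x = c\<rbrakk> \<Longrightarrow>
      \<exists>y\<in>J. p y = (\<not> c) \<and> (\<forall>x\<in>F. R1 y x)"
    and Aut_parts: "\<lbrakk>coloured_iso J p R1 R2 R1 R2 \<tau>; x \<in> J\<rbrakk> \<Longrightarrow> p (\<tau> x) = p x"

locale realisation = generic_bipartite B q + coloured_target J p R1 R2
  for B :: "'b bstruct" and q and J :: "'j set" and p R1 R2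
begin

definition "e = from_nat_into J"

lemma e_J: "e n \<in> J"
  unfolding e_def using infinite_J by (intro from_nat_into) auto

lemma e_surj: "x \<in> J \<Longrightarrow> \<exists>n. e n = x"
  unfolding e_def by (rule from_nat_into_surj[OF countable_J])

lemma e_inj: "inj e"
  unfolding e_def inj_def using countable_J infinite_J by simp

text \<open>The new vertex \<open>c n\<close> is not adjacent to those of \<open>b 0, \<dots>, b n\<close> that are not yet in the image, which
  makes the number of neighbours in the image finite for every vertex outside of it.\<close>

lemma sparse_embedding:
  obtains \<iota> where "inj_on \<iota> J" "\<iota> ` J \<subseteq> verts B" "\<And>x. x \<in> J \<Longrightarrow> q (\<iota> x) = p x"
    "\<And>x y. x \<in> J \<Longrightarrow> y \<in> J \<Longrightarrow> (\<iota> x, \<iota> y) \<in> edges B \<longleftrightarrow> R2 x y"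
    "\<And>w. w \<in> verts B - \<iota> ` J \<Longrightarrow> finite {x \<in> \<iota> ` J. (w, x) \<in> edges B}"
proof -
  define P where "P c n r \<longleftrightarrow> r \<in> verts B \<and> q r = p (e n) \<and> r \<notin> c ` {..<n} \<and>
    (\<forall>m<n. (r, c m) \<in> edges B \<longleftrightarrow> R2 (e n) (e m)) \<and>
    (\<forall>i\<le>n. b i \<notin> c ` {..<n} \<longrightarrow> (r, b i) \<notin> edges B)" for c :: "nat \<Rightarrow> 'b" and n r
  have "\<exists>c. \<forall>n. P c n (c n)"
  proof (rule dependent_wellorder_choice)
    show "P f n r = P g n r" if "\<And>m. m < n \<Longrightarrow> f m = g m" for r f g n
    proof -
      have "f ` {..<n} = g ` {..<n}" using that by (intro image_cong) auto
      then show ?thesis using that unfolding P_def by auto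
    qed
    fix n c assume IH: "\<And>m. m < n \<Longrightarrow> P c m (c m)"
    let ?U = "c ` {m. m < n \<and> R2 (e n) (e m)}"
    let ?N = "c ` {..<n} \<union> b ` {..n} - ?U"
    have inj: "m = m'" if "m < n" "m' < n" "c m = c m'" for m m'
      using that IH[of m] IH[of m'] unfolding P_def
      by (metis imageI lessThan_iff linorder_neqE_nat)
    have "\<forall>u\<in>?U. q u = (\<not> p (e n))"
      using IH R2_parts unfolding P_def by auto
    moreover have "?U \<subseteq> verts B" "?N \<subseteq> verts B" using IH b_verts unfolding P_def by auto
    moreover have "finite ?U" "finite ?N" "?U \<inter> ?N = {}" by auto
    ultimately obtain v where v: "v \<in> verts B - (?U \<union> ?N)" "q v = p (e n)"
      "\<forall>u\<in>?U. (v, u) \<in> edges B" "\<forall>u\<in>?N. (v, u) \<notin> edges B"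
      using extension[of ?U ?N "\<not> p (e n)"] by auto
    have "c m \<in> ?N" if "m < n" "\<not> R2 (e n) (e m)" for m
      using that inj by auto
    then have "\<forall>m<n. (v, c m) \<in> edges B \<longleftrightarrow> R2 (e n) (e m)" using v(3,4) by blast
    moreover have "v \<notin> c ` {..<n}" using v(1) by auto
    moreover have "\<forall>i\<le>n. b i \<notin> c ` {..<n} \<longrightarrow> (v, b i) \<notin> edges B"
      using v(4) by auto
    ultimately show "\<exists>r. P c n r" using v(1,2) unfolding P_def by blast
  qed
  then obtain c where c: "\<And>n. P c n (c n)" by blast
  define \<iota> where "\<iota> = c \<circ> inv_into UNIV e"
  have \<iota>e: "\<iota> (e n) = c n" for n
    unfolding \<iota>_def using e_inj by (simp add: inv_f_f)
  have im: "\<iota> ` J = range c"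
    using \<iota>e e_J e_surj by (auto simp: image_iff) metis+
  have c_inj: "m = n" if "c m = c n" for m n
    using that c[of m] c[of n] unfolding P_def
    by (metis imageI lessThan_iff linorder_neqE_nat)
  have c_edge: "(c m, c n) \<in> edges B \<longleftrightarrow> R2 (e m) (e n)" for m n
  proof (cases m n rule: linorder_cases)
    case less
    then show ?thesis using c[of n] edge_sym R2_sym unfolding P_def by metis
  next
    case equal
    then show ?thesis using edge_irrefl R2_parts by blast
  next
    case greater
    then show ?thesis using c[of m] unfolding P_def by blast
  qed
  show thesis
  proof
    show "inj_on \<iota> J" using \<iota>e e_surj c_inj by (metis inj_onI)
    show "\<iota> ` J \<subseteq> verts B" using im c unfolding P_def by auto
    show "q (\<iota> x) = p x" if "x \<in> J" for x
      using e_surj[OF that] \<iota>e c unfolding P_def by metis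
    show "(\<iota> x, \<iota> y) \<in> edges B \<longleftrightarrow> R2 x y" if "x \<in> J" "y \<in> J" for x y
      using e_surj[OF that(1)] e_surj[OF that(2)] \<iota>e c_edge by metis
    show "finite {x \<in> \<iota> ` J. (w, x) \<in> edges B}" if w: "w \<in> verts B - \<iota> ` J" for w
    proof -
      \<comment> \<open>At stages \<open>n \<ge> k\<close> the vertex \<open>w = b k\<close> is
        excluded as a neighbour, since it never enters the image.\<close>
      obtain k where k: "b k = w" using b_surj w by blast
      have "n < k" if "(w, c n) \<in> edges B" for n
      proof (rule ccontr)
        assume "\<not> n < k"
        moreover have "b k \<notin> c ` {..<n}" using w k im by auto
        ultimately have "(c n, w) \<notin> edges B" using c[of n] k unfolding P_def by auto
        then show False using that edge_sym by blast
      qed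
      then have "{x \<in> \<iota> ` J. (w, x) \<in> edges B} \<subseteq> c ` {..<k}" unfolding im by auto
      then show ?thesis by (rule finite_subset) simp
    qed
  qed
qed

text \<open>Either a prescribed vertex \<open>w\<close> receives a value, or, for a pair \<open>(F, y)\<close>, a new vertex
  adjacent to all of \<open>F\<close> receives the value \<open>y\<close>.\<close>

lemma rich_homomorphism:
  obtains f0 where "\<And>w. w \<in> verts B \<Longrightarrow> f0 w \<in> J \<and> p (f0 w) = q w"
    "\<And>u v. (u, v) \<in> edges B \<Longrightarrow> R1 (f0 u) (f0 v)"
    "\<And>F y. finite F \<Longrightarrow> F \<subseteq> verts B \<Longrightarrow> y \<in> J \<Longrightarrow> (\<And>u. u \<in> F \<Longrightarrow> R1 y (f0 u)) \<Longrightarrow>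
      \<exists>v\<in>verts B. f0 v = y \<and> (\<forall>u\<in>F. (v, u) \<in> edges B)"
proof -
  let ?W = "verts B"
  let ?D = "?W <+> ({F. finite F \<and> F \<subseteq> ?W} \<times> J)"
  define d where "d = from_nat_into ?D"
  have "countable ?D"
    using countable_verts countable_J countable_Collect_finite_subset by blast
  moreover have "?D \<noteq> {}" using b_verts by blast
  ultimately have d: "d n \<in> ?D" and d_surj: "z \<in> ?D \<Longrightarrow> \<exists>n. d n = z" for n z
    unfolding d_def by (auto intro: from_nat_into from_nat_into_surj)
  \<comment> \<open>The sequence lists pairs of a vertex and its value. A vertex may recur, and must
    then recur with the same value.\<close>
  define consistent where "consistent r r' \<longleftrightarrow> (fst r = fst r' \<longrightarrow> snd r = snd r') \<and>
    ((fst r, fst r') \<in> edges B \<longrightarrow> R1 (snd r) (snd r'))" for r r' :: "'b \<times> 'j"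
  \<comment> \<open>A pair \<open>(F, y)\<close> already violated by earlier values imposes nothing.
    Vertices of \<open>F\<close> without a value so far are joined to the new vertex too;
    consistency constrains their later values.\<close>
  define task where "task s n r \<longleftrightarrow> (case d n of Inl w \<Rightarrow> fst r = w
    | Inr (F, y) \<Rightarrow> (\<forall>u\<in>F. q u \<noteq> p y) \<and> (\<forall>m<n. fst (s m) \<in> F \<longrightarrow> R1 y (snd (s m))) \<longrightarrow>
        snd r = y \<and> (\<forall>u\<in>F. (fst r, u) \<in> edges B))" for s :: "nat \<Rightarrow> 'b \<times> 'j" and n r
  define P where "P s n r \<longleftrightarrow> fst r \<in> ?W \<and> snd r \<in> J \<and> p (snd r) = q (fst r) \<and>
    (\<forall>m<n. consistent r (s m)) \<and> task s n r" for s n r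
  have cons_sym: "consistent r r' \<Longrightarrow> consistent r' r" for r r'
    unfolding consistent_def using edge_sym R1_sym by metis
  have "\<exists>s. \<forall>n. P s n (s n)"
  proof (rule dependent_wellorder_choice)
    show "P f n r = P g n r" if "\<And>m. m < n \<Longrightarrow> f m = g m" for r f g n
    proof -
      have "task f n r = task g n r" using that unfolding task_def by (auto split: sum.split)
      then show ?thesis using that unfolding P_def by auto
    qed
    fix n s assume IH: "\<And>m. m < n \<Longrightarrow> P s m (s m)"
    have IH': "fst (s m) \<in> ?W" "snd (s m) \<in> J" "p (snd (s m)) = q (fst (s m))" if "m < n" for m
      using IH[OF that] unfolding P_def by auto
    have cons: "consistent (s m) (s m')" if "m < n" "m' < n" for m m'
    proof (cases m m' rule: linorder_cases)
      case less
      then show ?thesis using IH[OF that(2)] cons_sym unfolding P_def by blast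
    next
      case equal
      then show ?thesis using edge_irrefl by (simp add: consistent_def)
    next
      case greater
      then show ?thesis using IH[OF that(1)] unfolding P_def by blast
    qed
    have ex_value: "\<exists>y\<in>J. p y = q w \<and> (\<forall>m<n. consistent (w, y) (s m))" if w: "w \<in> ?W" for w
    proof (cases "\<exists>m<n. w = fst (s m)")
      case True
      then obtain m where m: "m < n" "w = fst (s m)" by blast
      then have "(w, snd (s m)) = s m" by simp
      then show ?thesis using cons m IH'[OF m(1)] by metis
    next
      case False
      let ?F = "(\<lambda>m. snd (s m)) ` {m. m < n \<and> (w, fst (s m)) \<in> edges B}"
      have "\<forall>x\<in>?F. p x = (\<not> q w)" using IH' edge_parts by fastforce
      moreover have "?F \<subseteq> J" "finite ?F" using IH' by auto
      ultimately obtain y where "y \<in> J" "p y = q w" "\<forall>x\<in>?F. R1 y x"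
        using common_neighbour[of ?F "\<not> q w"] by auto
      then show ?thesis using False unfolding consistent_def by auto
    qed
    show "\<exists>r. P s n r"
    proof (cases "d n")
      case (Inl w)
      then have "w \<in> ?W" using d[of n] by auto
      from ex_value[OF this] show ?thesis
        using Inl \<open>w \<in> ?W\<close> unfolding P_def task_def by force
    next
      case (Inr z)
      obtain F y where z: "z = (F, y)" by force
      have F: "finite F" "F \<subseteq> ?W" and y: "y \<in> J" using d[of n] Inr z by auto
      show ?thesis
      proof (cases "(\<forall>u\<in>F. q u \<noteq> p y) \<and> (\<forall>m<n. fst (s m) \<in> F \<longrightarrow> R1 y (snd (s m)))")
        case True
        \<comment> \<open>Avoiding all adjacency to earlier vertices outside \<open>F\<close> leaves
          only the conditions on \<open>y\<close> that come from \<open>F\<close>.\<close>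
        let ?N = "(\<lambda>m. fst (s m)) ` {..<n} - F"
        have "\<forall>u\<in>F. q u = (\<not> p y)" using True by auto
        moreover have "finite ?N" "?N \<subseteq> ?W" "F \<inter> ?N = {}" using IH' by auto
        ultimately obtain v where v: "v \<in> ?W - (F \<union> ?N)" "q v = p y"
          "\<forall>u\<in>F. (v, u) \<in> edges B" "\<forall>u\<in>?N. (v, u) \<notin> edges B"
          using extension[of F ?N "\<not> p y"] F by auto
        have "consistent (v, y) (s m)" if "m < n" for m
        proof (cases "fst (s m) \<in> F")
          case in_F: True
          then show ?thesis using v(1) True that unfolding consistent_def by auto
        next
          case False
          then have "fst (s m) \<in> ?N" using that by blast
          then show ?thesis using v(1,4) unfolding consistent_def by auto
        qed
        then have "P s n (v, y)" using v y Inr z unfolding P_def task_def by auto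
        then show ?thesis by blast
      next
        case False
        \<comment> \<open>The task is void, so any vertex with a consistent value fills the
          stage.\<close>
        from ex_value[OF b_verts[of 0]] obtain y' where "y' \<in> J" "p y' = q (b 0)"
          "\<forall>m<n. consistent (b 0, y') (s m)" by blast
        then have "P s n (b 0, y')"
          using b_verts False Inr z unfolding P_def task_def by auto
        then show ?thesis by blast
      qed
    qed
  qed
  then obtain s where s: "\<And>n. P s n (s n)" by blast
  have cons: "consistent (s m) (s m')" for m m'
  proof (cases m m' rule: linorder_cases)
    case less
    then show ?thesis using s[of m'] cons_sym unfolding P_def by blast
  next
    case equal
    then show ?thesis using edge_irrefl by (simp add: consistent_def)
  next
    case greater
    then show ?thesis using s[of m] unfolding P_def by blast
  qed
  have hit: "\<exists>n. fst (s n) = w" if w: "w \<in> ?W" for w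
  proof -
    obtain n where "d n = Inl w" using d_surj[of "Inl w"] w by blast
    then show ?thesis using s[of n] unfolding P_def task_def by auto
  qed
  \<comment> \<open>By consistency any stage at which \<open>w\<close> occurs gives the same
    value.\<close>
  define f0 where "f0 w = snd (s (SOME n. fst (s n) = w))" for w
  have f0: "f0 (fst (s n)) = snd (s n)" for n
  proof -
    have "fst (s (SOME k. fst (s k) = fst (s n))) = fst (s n)" by (rule someI) (rule refl)
    then show ?thesis using cons unfolding f0_def consistent_def by metis
  qed
  show thesis
  proof
    show "f0 w \<in> J \<and> p (f0 w) = q w" if "w \<in> ?W" for w
      using hit[OF that] f0 s unfolding P_def by metis
    show "R1 (f0 u) (f0 v)" if "(u, v) \<in> edges B" for u v
      using that hit edge_verts f0 cons unfolding consistent_def by metis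
    fix F y assume F: "finite F" "F \<subseteq> ?W" and y: "y \<in> J" and R: "\<And>u. u \<in> F \<Longrightarrow> R1 y (f0 u)"
    obtain n where n: "d n = Inr (F, y)" using d_surj[of "Inr (F, y)"] F y by blast
    have "q u \<noteq> p y" if u: "u \<in> F" for u
    proof -
      obtain m where m: "fst (s m) = u" using hit F(2) u by blast
      then have "p (f0 u) = q u" using f0[of m] s[of m] unfolding P_def by simp
      then show ?thesis using R2_parts[OF R1_R2[OF R[OF u]]] by auto
    qed
    moreover have "R1 y (snd (s m))" if "fst (s m) \<in> F" for m
      using R[OF that] f0 by simp
    ultimately have "snd (s n) = y \<and> (\<forall>u\<in>F. (fst (s n), u) \<in> edges B)"
      using s[of n] n unfolding P_def task_def by auto
    then show "\<exists>v\<in>?W. f0 v = y \<and> (\<forall>u\<in>F. (v, u) \<in> edges B)"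
      using f0[of n] s[of n] unfolding P_def by auto
  qed
qed

text \<open>\<open>f\<close> is the rich homomorphism followed by the sparse embedding: sparseness
  extends an automorphism from the image, richness lifts it through \<open>f\<close>.\<close>

lemma ex_represents: "\<exists>f \<iota>. represents B J p R1 R2 f \<iota>"
proof -
  let ?W = "verts B" and ?M = "End_monoid B"
  obtain \<iota> where \<iota>: "inj_on \<iota> J" "\<iota> ` J \<subseteq> ?W" "\<And>x. x \<in> J \<Longrightarrow> q (\<iota> x) = p x"
    "\<And>x y. x \<in> J \<Longrightarrow> y \<in> J \<Longrightarrow> (\<iota> x, \<iota> y) \<in> edges B \<longleftrightarrow> R2 x y"
    and sparse: "\<And>w. w \<in> ?W - \<iota> ` J \<Longrightarrow> finite {x \<in> \<iota> ` J. (w, x) \<in> edges B}"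
    by (rule sparse_embedding) blast
  obtain f0 where f0: "\<And>w. w \<in> ?W \<Longrightarrow> f0 w \<in> J \<and> p (f0 w) = q w"
    and f0_edge: "\<And>u v. (u, v) \<in> edges B \<Longrightarrow> R1 (f0 u) (f0 v)"
    and rich: "\<And>F y. finite F \<Longrightarrow> F \<subseteq> ?W \<Longrightarrow> y \<in> J \<Longrightarrow> (\<And>u. u \<in> F \<Longrightarrow> R1 y (f0 u)) \<Longrightarrow>
      \<exists>v\<in>?W. f0 v = y \<and> (\<forall>u\<in>F. (v, u) \<in> edges B)"
    by (rule rich_homomorphism) blast
  have \<iota>W: "\<iota> x \<in> ?W" if "x \<in> J" for x using \<iota>(2) that by blast
  have \<iota>_eq: "\<iota> x = \<iota> y \<longleftrightarrow> x = y" if "x \<in> J" "y \<in> J" for x y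
    using \<iota>(1) that by (simp add: inj_on_eq_iff)
  define f where "f = (\<lambda>w\<in>?W. \<iota> (f0 w))"
  have f: "f w = \<iota> (f0 w)" if "w \<in> ?W" for w using that by (simp add: f_def)
  have f0_onto: "\<exists>w\<in>?W. f0 w = y" if "y \<in> J" for y
    using rich[of "{}" y] that by auto
  have R1: "R1 x y \<longleftrightarrow> (\<exists>u v. (u, v) \<in> edges B \<and> f u = \<iota> x \<and> f v = \<iota> y)"
    if xy: "x \<in> J" "y \<in> J" for x y
  proof
    \<comment> \<open>Richness for the singleton of a vertex over \<open>y\<close> supplies an
      adjacent vertex over \<open>x\<close>.\<close>
    assume R: "R1 x y"
    obtain v where v: "v \<in> ?W" "f0 v = y" using f0_onto[OF xy(2)] by blast
    obtain u where u: "u \<in> ?W" "f0 u = x" "(u, v) \<in> edges B"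
      using rich[of "{v}" x] v xy R by auto
    then show "\<exists>u v. (u, v) \<in> edges B \<and> f u = \<iota> x \<and> f v = \<iota> y" using v f by metis
  next
    assume "\<exists>u v. (u, v) \<in> edges B \<and> f u = \<iota> x \<and> f v = \<iota> y"
    then obtain u v where uv: "(u, v) \<in> edges B" "f u = \<iota> x" "f v = \<iota> y" by blast
    have W: "u \<in> ?W" "v \<in> ?W" using edge_verts[OF uv(1)] by auto
    then have "f0 u = x" "f0 v = y"
      using uv f0[OF W(1)] f0[OF W(2)] \<iota>_eq xy by (auto simp: f)
    then show "R1 x y" using f0_edge[OF uv(1)] by simp
  qed
  have "homomorphism B B f"
    unfolding homomorphism_def
  proof (intro conjI allI impI)
    show "f \<in> ?W \<rightarrow> ?W" using f f0 \<iota>W by auto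
    show "(f u, f v) \<in> edges B" if "(u, v) \<in> edges B" for u v
      using that f0_edge R1_R2 \<iota>(4) f f0 edge_verts by metis
    show "(f u, f v) \<in> same_part B" if "(u, v) \<in> same_part B" for u v
      using that f f0 \<iota>W \<iota>(3) unfolding same_part_iff by metis
  qed
  then have f_End: "f \<in> carrier ?M" by (simp add: End_carrier_iff f_def)
  have "f ` ?W = \<iota> ` J"
  proof
    show "f ` ?W \<subseteq> \<iota> ` J" using f f0 by auto
    show "\<iota> ` J \<subseteq> f ` ?W" using f f0_onto by (metis imageI image_subsetI)
  qed
  then have bij: "bij_betw \<iota> J (f ` ?W)" using \<iota>(1) by (simp add: bij_betw_def)
  have "\<exists>t\<in>carrier ?M. \<exists>a\<in>carrier ?M.
      (\<forall>x\<in>J. t (\<iota> x) = \<iota> (\<tau> x)) \<and> (\<forall>w\<in>?W. f (a w) = t (f w))"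
    if \<tau>: "coloured_iso J p R1 R2 R1 R2 \<tau>" for \<tau>
  proof -
    have \<tau>J: "\<tau> x \<in> J" "p (\<tau> x) = p x" if "x \<in> J" for x
      using \<tau> that Aut_parts[OF \<tau>] by (auto simp: coloured_iso_def bij_betw_def)
    have \<tau>R: "R1 (\<tau> x) (\<tau> y) \<longleftrightarrow> R1 x y" "R2 (\<tau> x) (\<tau> y) \<longleftrightarrow> R2 x y" if "x \<in> J" "y \<in> J" for x y
      using \<tau> that by (auto simp: coloured_iso_def)
    have inv: "inv_into J \<iota> (\<iota> x) = x" if "x \<in> J" for x
      using \<iota>(1) that by (rule inv_into_f_f)
    have "\<exists>t\<in>carrier ?M. \<forall>x\<in>\<iota> ` J. t x = \<iota> (\<tau> (inv_into J \<iota> x))"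
    proof (rule End_extending[OF \<iota>(2) sparse])
      show "\<iota> (\<tau> (inv_into J \<iota> x)) \<in> ?W \<and> q (\<iota> (\<tau> (inv_into J \<iota> x))) = q x" if "x \<in> \<iota> ` J" for x
        using that inv \<tau>J \<iota>(3) \<iota>W by auto
      show "(\<iota> (\<tau> (inv_into J \<iota> x)), \<iota> (\<tau> (inv_into J \<iota> y))) \<in> edges B"
        if "x \<in> \<iota> ` J" "y \<in> \<iota> ` J" "(x, y) \<in> edges B" for x y
        using that inv \<tau>J \<iota>(4) \<tau>R by auto
    qed
    then obtain t where t: "t \<in> carrier ?M" "\<forall>x\<in>J. t (\<iota> x) = \<iota> (\<tau> x)" using inv by auto
    \<comment> \<open>A vertex \<open>w\<close> has to go into the fibre over
      \<open>\<tau> (f0 w)\<close>. Richness finds there a vertex adjacent to the finitely many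
      values of earlier neighbours.\<close>
    have "\<exists>a\<in>carrier ?M. \<forall>w\<in>?W. f0 (a w) = \<tau> (f0 w)"
    proof (rule End_from_choices)
      show "q r = q w" if "w \<in> ?W" "r \<in> ?W" "f0 r = \<tau> (f0 w)" for w r
        using f0[OF that(1)] f0[OF that(2)] that(3) \<tau>J by metis
      fix w F assume w: "w \<in> ?W" and F: "finite F"
        and FQ: "\<And>u r. (u, r) \<in> F \<Longrightarrow>
          u \<in> ?W \<and> r \<in> ?W \<and> (w, u) \<in> edges B \<and> f0 r = \<tau> (f0 u)"
      have "R1 (\<tau> (f0 w)) (f0 r)" if r: "r \<in> snd ` F" for r
      proof -
        obtain u where "(u, r) \<in> F" using r by auto
        from FQ[OF this] show ?thesis using f0_edge \<tau>R f0 w by metis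
      qed
      moreover have "snd ` F \<subseteq> ?W" using FQ by auto
      ultimately obtain v where "v \<in> ?W" "f0 v = \<tau> (f0 w)" "\<forall>r\<in>snd ` F. (v, r) \<in> edges B"
        using rich[of "snd ` F" "\<tau> (f0 w)"] F \<tau>J f0 w by auto
      then show "\<exists>r\<in>?W. f0 r = \<tau> (f0 w) \<and> (\<forall>(u, r')\<in>F. (r, r') \<in> edges B)" by force
    qed
    then obtain a where a: "a \<in> carrier ?M" "\<forall>w\<in>?W. f0 (a w) = \<tau> (f0 w)" by blast
    have "f (a w) = t (f w)" if "w \<in> ?W" for w
      using that a t f f0 End_verts[OF a(1)] by simp
    then show ?thesis using t a by blast
  qed
  moreover have "(\<iota> x, \<iota> y) \<in> same_part B \<longleftrightarrow> p x = p y" if "x \<in> J" "y \<in> J" for x y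
    using that \<iota>W \<iota>(3) by (simp add: same_part_iff)
  ultimately have "represents B J p R1 R2 f \<iota>"
    unfolding represents_def using f_End bij \<iota>(4) R1 by blast
  then show ?thesis by blast
qed

end

section \<open>Coding a graph and a set of natural numbers\<close>

text \<open>Each vertex of the graph gets a copy in either part, and a one-way infinite ray
  \<open>Inr 0, Inr 1, \<dots>\<close> alternates between the parts. The vertices of the graph are recovered as the
  pairs of matched vertices off the ray, and separation codes both the edges of the graph and the
  set \<open>S\<close>. Every vertex is joined to all sufficiently distant ray vertices of the other part.\<close>

definition code_verts :: "'a set \<Rightarrow> ('a \<times> bool + nat) set"
  where "code_verts V = (V \<times> UNIV) <+> UNIV"

fun code_side :: "'a \<times> bool + nat \<Rightarrow> bool"
  where "code_side (Inl (v, c)) = c"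
  | "code_side (Inr i) = even i"

fun matched :: "'a \<times> bool + nat \<Rightarrow> 'a \<times> bool + nat \<Rightarrow> bool"
  where "matched (Inl (u, c)) (Inl (v, d)) \<longleftrightarrow> u = v \<and> c \<noteq> d"
  | "matched (Inr i) (Inr j) \<longleftrightarrow> i = Suc j \<or> j = Suc i"
  | "matched _ _ \<longleftrightarrow> False"

text \<open>On the ray, 3 is the least odd distance other than 1: it joins opposite sides without
  meeting the matching.\<close>

fun separated :: "('a \<times> 'a) set \<Rightarrow> nat set \<Rightarrow> 'a \<times> bool + nat \<Rightarrow> 'a \<times> bool + nat \<Rightarrow> bool"
  where "separated E S (Inl (u, c)) (Inl (v, d)) \<longleftrightarrow> c \<noteq> d \<and> (u, v) \<in> E"
  | "separated E S (Inr i) (Inr j) \<longleftrightarrow> j = i + 3 \<and> i \<in> S \<or> i = j + 3 \<and> j \<in> S"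
  | "separated E S _ _ \<longleftrightarrow> False"

text \<open>The code works by omission: \<open>R2\<close> leaves out the separated pairs and
  \<open>R1\<close> the matched ones as well, so that both kinds can be recovered from the two
  relations.\<close>

definition "code_R2 E S x y \<longleftrightarrow> code_side x \<noteq> code_side y \<and> \<not> separated E S x y"

definition "code_R1 E S x y \<longleftrightarrow> code_R2 E S x y \<and> \<not> matched x y"

abbreviation "code_iso V E S S' \<equiv> coloured_iso (code_verts V) code_side
  (code_R1 E S) (code_R2 E S) (code_R1 E S') (code_R2 E S')"

lemma code_verts_simps [simp]:
  "Inl (v, c) \<in> code_verts V \<longleftrightarrow> v \<in> V" "Inr i \<in> code_verts V"
  by (auto simp: code_verts_def)

text \<open>Matched pairs survive in \<open>R2\<close>: irreflexivity of \<open>E\<close> keeps the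
  two copies of a vertex from being separated, and on the ray the distances 1 and 3 differ.\<close>

lemma matched_iff:
  assumes "irrefl E"
  shows "matched x y \<longleftrightarrow> code_R2 E S x y \<and> \<not> code_R1 E S x y"
proof -
  have "code_side x \<noteq> code_side y \<and> \<not> separated E S x y" if "matched x y"
    using that assms by (cases "(x, y)" rule: matched.cases) (auto simp: irrefl_def)
  then show ?thesis by (auto simp: code_R1_def code_R2_def)
qed

lemma separated_iff: "separated E S x y \<longleftrightarrow> code_side x \<noteq> code_side y \<and> \<not> code_R2 E S x y"
proof -
  have "code_side x \<noteq> code_side y" if "separated E S x y"
    using that by (cases "(E, S, x, y)" rule: separated.cases) auto
  then show ?thesis by (auto simp: code_R2_def)
qed

lemma matched_InlD: "matched (Inl (v, c)) y \<Longrightarrow> y = Inl (v, \<not> c)"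
  by (cases y) auto

lemma matched_InrD: "matched (Inr i) y \<Longrightarrow> \<exists>j. y = Inr j \<and> (i = Suc j \<or> j = Suc i)"
  by (cases y) auto

lemma matched_sym: "matched x y \<Longrightarrow> matched y x"
  by (cases "(x, y)" rule: matched.cases) auto

lemma separated_sym: "sym E \<Longrightarrow> separated E S x y \<Longrightarrow> separated E S y x"
  by (cases "(E, S, x, y)" rule: separated.cases) (auto dest: symD)

section \<open>Isomorphisms between the codes of two sets over the same graph\<close>

context
  fixes V :: "'a set" and E :: "('a \<times> 'a) set" and S S' :: "nat set" and \<phi>
  assumes irrefl: "irrefl E" and \<phi>: "code_iso V E S S' \<phi>"
begin

lemma code_iso_bij: "bij_betw \<phi> (code_verts V) (code_verts V)"
  using \<phi> by (simp add: coloured_iso_def)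

lemma code_iso_verts: "x \<in> code_verts V \<Longrightarrow> \<phi> x \<in> code_verts V"
  using code_iso_bij by (auto simp: bij_betw_def)

lemma code_iso_inj: "x \<in> code_verts V \<Longrightarrow> y \<in> code_verts V \<Longrightarrow> \<phi> x = \<phi> y \<longleftrightarrow> x = y"
  using code_iso_bij by (auto simp: bij_betw_def inj_on_eq_iff)

lemma code_iso_surj: "y \<in> code_verts V \<Longrightarrow> \<exists>x\<in>code_verts V. \<phi> x = y"
  using code_iso_bij by (metis bij_betw_imp_surj_on imageE)

lemma code_iso_matched:
  "x \<in> code_verts V \<Longrightarrow> y \<in> code_verts V \<Longrightarrow> matched (\<phi> x) (\<phi> y) \<longleftrightarrow> matched x y"
  unfolding matched_iff[OF irrefl, of x y S] matched_iff[OF irrefl, of "\<phi> x" "\<phi> y" S']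
  using \<phi> by (simp add: coloured_iso_def)

lemma code_iso_separated:
  "x \<in> code_verts V \<Longrightarrow> y \<in> code_verts V \<Longrightarrow> separated E S' (\<phi> x) (\<phi> y) \<longleftrightarrow> separated E S x y"
  unfolding separated_iff using \<phi> by (simp add: coloured_iso_def)

text \<open>Under matching the ray is the only component with more than two vertices, and
  \<open>Inr 0\<close> is its endpoint. Once the endpoint is fixed, the rest follows by
  induction.\<close>

lemma code_iso_ray: "\<phi> (Inr i) = Inr i"
proof -
  have m: "matched (\<phi> (Inr i)) (\<phi> (Inr (Suc i)))" for i
    using code_iso_matched[of "Inr i" "Inr (Suc i)"] by simp
  have 0: "\<phi> (Inr 0) = Inr 0"
  proof (cases "\<phi> (Inr 0)")
    \<comment> \<open>Off the ray, matching returns after two steps, so \<open>Inr 0\<close> and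
      \<open>Inr 2\<close> would have the same image.\<close>
    case (Inl a)
    obtain v c where "a = (v, c)" by force
    with Inl have "\<phi> (Inr 0) = Inl (v, c)" by simp
    moreover from this have 1: "\<phi> (Inr (Suc 0)) = Inl (v, \<not> c)"
      using m[of 0] matched_InlD by metis
    moreover have "\<phi> (Inr (Suc (Suc 0))) = Inl (v, c)"
      using m[of "Suc 0"] matched_InlD[of v "\<not> c"] 1 by simp
    ultimately show ?thesis using code_iso_inj[of "Inr 0" "Inr (Suc (Suc 0))"] by simp
  next
    case (Inr k)
    show ?thesis
    proof (cases k)
      \<comment> \<open>An inner ray vertex has two matched partners, whose preimages would both be
        \<open>Inr 1\<close>.\<close>
      case (Suc l)
      obtain x where x: "x \<in> code_verts V" "\<phi> x = Inr l"
        using code_iso_surj[of "Inr l"] by auto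
      obtain y where y: "y \<in> code_verts V" "\<phi> y = Inr (Suc k)"
        using code_iso_surj[of "Inr (Suc k)"] by auto
      have "matched (Inr 0) x" "matched (Inr 0) y"
        using code_iso_matched[of "Inr 0" x] code_iso_matched[of "Inr 0" y] x y Inr Suc by auto
      then have "x = Inr (Suc 0)" "y = Inr (Suc 0)" by (auto dest: matched_InrD)
      then show ?thesis using x y Suc by simp
    qed (use Inr in simp)
  qed
  show ?thesis
  proof (induction i rule: less_induct)
    case (less i)
    show ?case
    proof (cases i)
      case (Suc n)
      have n: "\<phi> (Inr n) = Inr n" using less Suc by simp
      obtain j where j: "\<phi> (Inr i) = Inr j" "n = Suc j \<or> j = Suc n"
        using m[of n] matched_InrD n Suc by metis
      show ?thesis
      proof (cases "j = i")
        \<comment> \<open>The other matched neighbour of \<open>Inr n\<close> is the image of itself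
          already, so injectivity excludes it.\<close>
        case False
        then have "n = Suc j" using j Suc by auto
        then have "\<phi> (Inr j) = \<phi> (Inr i)" using less[of j] j Suc by simp
        then show ?thesis using code_iso_inj[of "Inr j" "Inr i"] j by simp
      qed (use j in simp)
    qed (use 0 in simp)
  qed
qed

lemma code_iso_same_set: "S = S'"
proof -
  have "i \<in> S \<longleftrightarrow> i \<in> S'" for i
    using code_iso_separated[of "Inr i" "Inr (i + 3)"] by (simp add: code_iso_ray)
  then show ?thesis by blast
qed

text \<open>An isomorphism keeps or exchanges the sides as a whole; the fixed vertex
  \<open>Inr 0\<close> rules out the exchange.\<close>

lemma code_iso_side: "x \<in> code_verts V \<Longrightarrow> code_side (\<phi> x) = code_side x"
proof -
  assume x: "x \<in> code_verts V"
  have "code_side (\<phi> x) = code_side (\<phi> (Inr 0)) \<longleftrightarrow> code_side x = code_side (Inr 0 :: 'a \<times> bool + nat)"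
    using \<phi> x unfolding coloured_iso_def by (metis code_verts_simps(2))
  then show ?thesis by (simp add: code_iso_ray)
qed

text \<open>The fixed ray leaves no room for images of other vertices. Sides are kept, and matching
  forces the two copies of \<open>v\<close> to go to copies of one vertex.\<close>

lemma code_iso_Inl:
  assumes "v \<in> V"
  shows "\<exists>w\<in>V. \<forall>c. \<phi> (Inl (v, c)) = Inl (w, c)"
proof -
  have not_ray: "\<phi> (Inl (v, c)) \<noteq> Inr i" for c i
    using code_iso_inj[of "Inl (v, c)" "Inr i"] assms by (simp add: code_iso_ray)
  have "\<exists>w\<in>V. \<phi> (Inl (v, c)) = Inl (w, c)" for c
  proof (cases "\<phi> (Inl (v, c))")
    case (Inl a)
    then show ?thesis
      using code_iso_side[of "Inl (v, c)"] code_iso_verts[of "Inl (v, c)"] assms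
      by (cases a) auto
  qed (use not_ray in simp)
  then obtain w where w: "w c \<in> V" "\<phi> (Inl (v, c)) = Inl (w c, c)" for c by metis
  have "w c = w d" for c d
    using code_iso_matched[of "Inl (v, False)" "Inl (v, True)"] assms w
    by (cases c; cases d) auto
  then show ?thesis using w by metis
qed

end

text \<open>Distant ray vertices serve as common neighbours, and the rigid ray makes automorphisms
  keep the sides.\<close>

lemma code_target:
  assumes "graph V E" "countable V"
  shows "coloured_target (code_verts V) code_side (code_R1 E S) (code_R2 E S)"
proof
  have E: "irrefl E" "sym E" using assms(1) by (auto simp: graph_def)
  show "countable (code_verts V)" using assms(2) by (auto simp: code_verts_def)
  have "range Inr \<subseteq> code_verts V" by auto
  then show "infinite (code_verts V)"
    using finite_subset range_inj_infinite[of "Inr :: nat \<Rightarrow> 'a \<times> bool + nat"] by auto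
  show "code_R2 E S x y" if "code_R1 E S x y" for x y using that by (simp add: code_R1_def)
  show R2_sym: "code_R2 E S y x" if "code_R2 E S x y" for x y
    using that separated_sym[OF E(2)] unfolding code_R2_def by metis
  show "code_R1 E S y x" if "code_R1 E S x y" for x y
    using that R2_sym matched_sym unfolding code_R1_def by metis
  show "code_side x \<noteq> code_side y" if "code_R2 E S x y" for x y
    using that by (simp add: code_R2_def)
  show "code_side (\<tau> x) = code_side x" if "code_iso V E S S \<tau>" "x \<in> code_verts V" for \<tau> x
    using code_iso_side[OF E(1) that] .
  fix F :: "('a \<times> bool + nat) set" and c assume F: "finite F" "\<forall>x\<in>F. code_side x = c"
  have "finite (Inr -` F :: nat set)" using F(1) by (intro finite_vimageI) auto
  then obtain k where k: "\<forall>i\<in>Inr -` F. i < k" using finite_nat_set_iff_bounded by blast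
  \<comment> \<open>The parity puts \<open>Inr n\<close> on the side opposite to \<open>c\<close>;
    being more than 3 beyond every ray vertex in \<open>F\<close>, it is neither matched to nor
    separated from any of them.\<close>
  define n where "n = 2 * k + (if c then 7 else 6)"
  have n: "even n \<longleftrightarrow> \<not> c" "n > k + 3" by (auto simp: n_def)
  have "code_R1 E S (Inr n) x" if x: "x \<in> F" for x
  proof (cases x)
    case (Inl a)
    then show ?thesis using F(2) x n by (cases a) (auto simp: code_R1_def code_R2_def)
  next
    case (Inr i)
    then have "i < k" using k x by auto
    then show ?thesis using F(2) x n Inr by (auto simp: code_R1_def code_R2_def)
  qed
  then show "\<exists>y\<in>code_verts V. code_side y = (\<not> c) \<and> (\<forall>x\<in>F. code_R1 E S y x)"
    using n by (intro bexI[of _ "Inr n"]) auto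
qed

text \<open>\<open>\<Theta> \<sigma>\<close> applies \<open>\<sigma>\<close> to both copies of
  \<open>V\<close> and fixes the ray. Rigidity of the ray and of the matching leaves no other
  automorphisms.\<close>

lemma Aut_graph_iso_code:
  assumes E: "graph V E"
  shows "Aut_graph V E \<cong> coloured_Aut (code_verts V) code_side (code_R1 E S) (code_R2 E S)"
    (is "?G \<cong> ?A")
proof -
  let ?J = "code_verts V"
  have irr: "irrefl E" using E by (simp add: graph_def)
  define \<Theta> where "\<Theta> \<sigma> = (\<lambda>x\<in>?J. case x of Inl (v, c) \<Rightarrow> Inl (\<sigma> v, c) | Inr i \<Rightarrow> Inr i)"
    for \<sigma> :: "'a \<Rightarrow> 'a"
  have G: "\<sigma> \<in> carrier ?G \<longleftrightarrow> \<sigma> \<in> extensional V \<and> bij_betw \<sigma> V V \<and>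
      (\<forall>u\<in>V. \<forall>v\<in>V. (\<sigma> u, \<sigma> v) \<in> E \<longleftrightarrow> (u, v) \<in> E)" for \<sigma>
    by (simp add: Aut_graph_def)
  have A: "\<tau> \<in> carrier ?A \<longleftrightarrow> \<tau> \<in> extensional ?J \<and> code_iso V E S S \<tau>" for \<tau>
    by (simp add: coloured_Aut_def)
  have \<Theta>_simps: "\<Theta> \<sigma> (Inr i) = Inr i" "v \<in> V \<Longrightarrow> \<Theta> \<sigma> (Inl (v, c)) = Inl (\<sigma> v, c)" for \<sigma> i v c
    by (auto simp: \<Theta>_def)
  have J_cases: "(\<exists>v c. x = Inl (v, c) \<and> v \<in> V) \<or> (\<exists>i. x = Inr i)" if "x \<in> ?J" for x
    using that by (cases x) auto
  have \<Theta>_A: "\<Theta> \<sigma> \<in> carrier ?A" if \<sigma>: "\<sigma> \<in> carrier ?G" for \<sigma>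
  proof -
    have \<sigma>V: "\<sigma> v \<in> V" if "v \<in> V" for v using \<sigma> that by (auto simp: G bij_betw_def)
    have \<sigma>_inj: "\<sigma> u = \<sigma> v \<longleftrightarrow> u = v" if "u \<in> V" "v \<in> V" for u v
      using \<sigma> that by (auto simp: G bij_betw_def inj_on_eq_iff)
    have "bij_betw (\<Theta> \<sigma>) ?J ?J"
      unfolding bij_betw_def
    proof
      show "inj_on (\<Theta> \<sigma>) ?J"
        unfolding inj_on_def using J_cases by (auto simp: \<Theta>_simps \<sigma>_inj dest!: J_cases)
      show "\<Theta> \<sigma> ` ?J = ?J"
      proof
        show "\<Theta> \<sigma> ` ?J \<subseteq> ?J" by (auto simp: \<Theta>_simps \<sigma>V dest!: J_cases)
        show "?J \<subseteq> \<Theta> \<sigma> ` ?J"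
        proof
          fix y assume "y \<in> ?J"
          from J_cases[OF this] show "y \<in> \<Theta> \<sigma> ` ?J"
          proof
            assume "\<exists>v c. y = Inl (v, c) \<and> v \<in> V"
            then obtain v c where y: "y = Inl (v, c)" "v \<in> V" by blast
            have "\<sigma> ` V = V" using \<sigma> by (simp add: G bij_betw_def)
            then obtain u where "u \<in> V" "v = \<sigma> u" using y(2) by blast
            then show ?thesis using y by (intro image_eqI[of _ _ "Inl (u, c)"]) (auto simp: \<Theta>_simps)
          next
            assume "\<exists>i. y = Inr i"
            then show ?thesis by (metis \<Theta>_simps(1) code_verts_simps(2) imageI)
          qed
        qed
      qed
    qed
    moreover have "code_side (\<Theta> \<sigma> x) = code_side x" if "x \<in> ?J" for x
      using J_cases[OF that] by (auto simp: \<Theta>_simps)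
    moreover have "matched (\<Theta> \<sigma> x) (\<Theta> \<sigma> y) \<longleftrightarrow> matched x y"
      "separated E S (\<Theta> \<sigma> x) (\<Theta> \<sigma> y) \<longleftrightarrow> separated E S x y" if "x \<in> ?J" "y \<in> ?J" for x y
      using J_cases[OF that(1)] J_cases[OF that(2)] \<sigma>
      by (auto simp: \<Theta>_simps \<sigma>_inj G)
    ultimately show ?thesis
      unfolding A coloured_iso_def code_R1_def code_R2_def by (simp add: \<Theta>_def)
  qed
  have "inj_on \<Theta> (carrier ?G)"
  proof (rule inj_onI)
    fix \<sigma> \<rho> assume \<sigma>: "\<sigma> \<in> carrier ?G" "\<rho> \<in> carrier ?G" and eq: "\<Theta> \<sigma> = \<Theta> \<rho>"
    have "\<sigma> v = \<rho> v" if "v \<in> V" for v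
      using fun_cong[OF eq, of "Inl (v, True)"] that by (simp add: \<Theta>_simps)
    then show "\<sigma> = \<rho>" using \<sigma> by (auto simp: G intro: extensionalityI)
  qed
  moreover have "\<Theta> ` carrier ?G = carrier ?A"
  proof
    show "\<Theta> ` carrier ?G \<subseteq> carrier ?A" using \<Theta>_A by blast
    show "carrier ?A \<subseteq> \<Theta> ` carrier ?G"
    proof
      fix \<tau> assume \<tau>: "\<tau> \<in> carrier ?A"
      then have iso: "code_iso V E S S \<tau>" by (simp add: A)
      note c = code_iso_ray[OF irr iso] code_iso_Inl[OF irr iso]
      obtain \<sigma>' where \<sigma>': "\<And>v. v \<in> V \<Longrightarrow> \<sigma>' v \<in> V \<and> (\<forall>c. \<tau> (Inl (v, c)) = Inl (\<sigma>' v, c))"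
        using c(2) by metis
      define \<sigma> where "\<sigma> = restrict \<sigma>' V"
      have \<sigma>: "\<sigma> v \<in> V" "\<tau> (Inl (v, c)) = Inl (\<sigma> v, c)" if "v \<in> V" for v c
        using \<sigma>'[OF that] that by (auto simp: \<sigma>_def)
      have "inj_on \<sigma> V"
      proof (rule inj_onI)
        fix u v assume uv: "u \<in> V" "v \<in> V" "\<sigma> u = \<sigma> v"
        then have "\<tau> (Inl (u, True)) = \<tau> (Inl (v, True))" using \<sigma> by simp
        then show "u = v" using code_iso_inj[OF irr iso] uv by auto
      qed
      moreover have "V \<subseteq> \<sigma> ` V"
      proof
        fix w assume "w \<in> V"
        then obtain x where x: "x \<in> ?J" "\<tau> x = Inl (w, True)"
          using code_iso_surj[OF irr iso, of "Inl (w, True)"] by auto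
        from J_cases[OF x(1)] show "w \<in> \<sigma> ` V"
          using x c(1) \<sigma> by auto
      qed
      ultimately have "bij_betw \<sigma> V V" using \<sigma>(1) by (auto simp: bij_betw_def)
      \<comment> \<open>Separation between copies on opposite sides is adjacency in the
        graph.\<close>
      moreover have "(\<sigma> u, \<sigma> v) \<in> E \<longleftrightarrow> (u, v) \<in> E" if "u \<in> V" "v \<in> V" for u v
        using code_iso_separated[OF irr iso, of "Inl (u, True)" "Inl (v, False)"] that \<sigma> by simp
      ultimately have "\<sigma> \<in> carrier ?G" by (simp add: G \<sigma>_def)
      moreover have "\<tau> = \<Theta> \<sigma>"
      proof (rule extensionalityI)
        show "\<tau> \<in> extensional ?J" using \<tau> by (simp add: A)
        show "\<Theta> \<sigma> \<in> extensional ?J" by (simp add: \<Theta>_def)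
        show "\<tau> x = \<Theta> \<sigma> x" if "x \<in> ?J" for x
          using J_cases[OF that] c(1) \<sigma> by (auto simp: \<Theta>_simps)
      qed
      ultimately show "\<tau> \<in> \<Theta> ` carrier ?G" by blast
    qed
  qed
  moreover have "\<Theta> (\<sigma> \<otimes>\<^bsub>?G\<^esub> \<rho>) = \<Theta> \<sigma> \<otimes>\<^bsub>?A\<^esub> \<Theta> \<rho>" if "\<sigma> \<in> carrier ?G" "\<rho> \<in> carrier ?G" for \<sigma> \<rho>
  proof (rule extensionalityI)
    show "\<Theta> (\<sigma> \<otimes>\<^bsub>?G\<^esub> \<rho>) \<in> extensional ?J" by (simp add: \<Theta>_def)
    show "\<Theta> \<sigma> \<otimes>\<^bsub>?A\<^esub> \<Theta> \<rho> \<in> extensional ?J" by (simp add: coloured_Aut_def)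
    show "\<Theta> (\<sigma> \<otimes>\<^bsub>?G\<^esub> \<rho>) x = (\<Theta> \<sigma> \<otimes>\<^bsub>?A\<^esub> \<Theta> \<rho>) x" if x: "x \<in> ?J" for x
    proof -
      have "\<sigma> v \<in> V" if "v \<in> V" for v
        using \<open>\<sigma> \<in> carrier ?G\<close> that by (auto simp: G bij_betw_def)
      then show ?thesis
        using J_cases[OF x] by (auto simp: \<Theta>_simps Aut_graph_def coloured_Aut_def compose_eq)
    qed
  qed
  ultimately have "\<Theta> \<in> iso ?G ?A" using \<Theta>_A by (auto simp: iso_def hom_def bij_betw_def)
  then show ?thesis by (auto simp: is_iso_def)
qed

lemma Aut_graph_closed:
  assumes "\<sigma> \<in> carrier (Aut_graph V E)" "\<rho> \<in> carrier (Aut_graph V E)"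
  shows "\<sigma> \<otimes>\<^bsub>Aut_graph V E\<^esub> \<rho> \<in> carrier (Aut_graph V E)"
proof -
  have "bij_betw \<sigma> V V" "bij_betw \<rho> V V" using assms by (auto simp: Aut_graph_def)
  then have "bij_betw (compose V \<rho> \<sigma>) V V" by (rule bij_betw_compose)
  moreover have "\<sigma> v \<in> V" if "v \<in> V" for v
    using \<open>bij_betw \<sigma> V V\<close> that by (auto simp: bij_betw_def)
  ultimately show ?thesis using assms by (auto simp: Aut_graph_def compose_eq)
qed

section \<open>Counting the D-classes\<close>

lemma Green_D_represents:
  assumes "is_structure B" "represents B J p R1 R2 f \<iota>" "(f, g) \<in> Green_D (End_monoid B)"
  shows "\<exists>\<kappa>. represents B J p R1 R2 g \<kappa>"
proof -
  obtain h where h: "(f, h) \<in> Green_L (End_monoid B)" "(h, g) \<in> Green_R (End_monoid B)"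
    using assms(3) by (auto simp: Green_D_def)
  interpret f: represented B J p R1 R2 f \<iota> using assms by unfold_locales
  interpret h: represented B J p R1 R2 h \<iota>
    using assms(1) f.Green_L_represents[OF h(1)] by unfold_locales
  show ?thesis using h.Green_R_represents[OF h(2)] .
qed

text \<open>An endomorphism is determined by its graph, which pairing of indices turns into a set of
  natural numbers.\<close>

lemma End_lepoll_continuum:
  assumes "countable (verts B)"
  shows "carrier (End_monoid B) \<lesssim> (UNIV :: nat set set)"
proof -
  let ?W = "verts B" and ?n = "to_nat_on (verts B)"
  define code where "code f = (\<lambda>w. prod_encode (?n w, ?n (f w))) ` ?W" for f
  have "inj_on code (carrier (End_monoid B))"
  proof (rule inj_onI)
    fix f g assume f: "f \<in> carrier (End_monoid B)" and g: "g \<in> carrier (End_monoid B)"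
      and eq: "code f = code g"
    show "f = g"
    proof (rule End_eqI[OF f g])
      fix w assume w: "w \<in> ?W"
      then have "prod_encode (?n w, ?n (f w)) \<in> code f" unfolding code_def by (rule imageI)
      then have "prod_encode (?n w, ?n (f w)) \<in> code g" using eq by simp
      then obtain w' where w': "w' \<in> ?W" "?n w = ?n w'" "?n (f w) = ?n (g w')"
        unfolding code_def by auto
      then have "w = w'" using assms w by simp
      then show "f w = g w" using w' assms End_verts[OF f w] End_verts[OF g w] by simp
    qed
  qed
  then show ?thesis unfolding lepoll_def by blast
qed

theorem theorem5p11:
  fixes V :: "'a set" and E :: "('a \<times> 'a) set" and B :: "'b bstruct"
  assumes "graph V E" and "countable V"
    and "universal_bipartite_graph B"
  shows "{D \<in> nonregular_D_classes (End_monoid B).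
            \<forall>H \<in> H_classes (End_monoid B). H \<subseteq> D \<longrightarrow>
              Schuetzenberger_group (End_monoid B) H \<cong> Aut_graph V E}
         \<approx> (UNIV :: nat set set)"
    (is "?X \<approx> _")
proof (rule lepoll_antisym)
  let ?M = "End_monoid B"
  let ?rep = "\<lambda>S. represents B (code_verts V) code_side (code_R1 E S) (code_R2 E S)"
  obtain q where q: "generic_bipartite B q"
    using universal_bipartite_graph_generic[OF assms(3)] by blast
  interpret generic_bipartite B q by (rule q)
  interpret monoid ?M using is_structure_B by (rule monoid_End)
  have irr: "irrefl E" using assms(1) by (simp add: graph_def)

  \<comment> \<open>Upper bound: each class is the class of some endomorphism.\<close>
  have "?X \<subseteq> (\<lambda>f. Green_D ?M `` {f}) ` carrier ?M"
    by (auto simp: nonregular_D_classes_def quotient_def)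
  then have "?X \<lesssim> carrier ?M" by (rule subset_image_lepoll)
  also have "carrier ?M \<lesssim> (UNIV :: nat set set)"
    using countable_verts by (rule End_lepoll_continuum)
  finally show "?X \<lesssim> (UNIV :: nat set set)" .

  \<comment> \<open>Lower bound: each set \<open>S\<close> of natural numbers contributes one
    class.\<close>
  have "\<exists>f \<iota>. ?rep S f \<iota>" for S
  proof -
    interpret realisation B q "code_verts V" code_side "code_R1 E S" "code_R2 E S"
      using q code_target[OF assms(1,2)] by (simp add: realisation_def)
    show ?thesis by (rule ex_represents)
  qed
  then obtain f \<iota> where f: "?rep S (f S) (\<iota> S)" for S by metis
  have f_End: "f S \<in> carrier ?M" for S using f[of S] by (simp add: represents_def)
  define D where "D S = Green_D ?M `` {f S}" for S
  have D_rep: "\<exists>\<kappa>. ?rep S g \<kappa>" if "g \<in> D S" for g S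
    using Green_D_represents[OF is_structure_B f] that by (simp add: D_def)
  have "D S \<in> ?X" for S
  proof -
    have "\<not> regular_element ?M g" if g: "g \<in> D S" for g
    proof -
      obtain \<kappa> where "?rep S g \<kappa>" using D_rep[OF g] by blast
      then interpret g: represented B "code_verts V" code_side "code_R1 E S" "code_R2 E S" g \<kappa>
        using is_structure_B by unfold_locales
      \<comment> \<open>\<open>Inr 0\<close> and \<open>Inr 1\<close> are matched, hence related by
        \<open>R2\<close> and not by \<open>R1\<close>.\<close>
      show ?thesis
        by (rule g.not_regular[of "Inr 0" "Inr 1"]) (auto simp: code_R1_def code_R2_def)
    qed
    moreover have "Schuetzenberger_group ?M H \<cong> Aut_graph V E"
      if H: "H \<in> H_classes ?M" "H \<subseteq> D S" for H
    proof -
      obtain g where g: "g \<in> carrier ?M" "H = Green_H ?M `` {g}"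
        using H(1) by (auto simp: H_classes_def quotient_def)
      \<comment> \<open>Since \<open>H\<close> contains \<open>g\<close> and lies in
        \<open>D S\<close>, the element \<open>g\<close> carries a representation of its own, from
        which the group of \<open>H\<close> is computed.\<close>
      then have "g \<in> D S" using H(2) Green_H_refl by blast
      then obtain \<kappa> where "?rep S g \<kappa>" using D_rep by blast
      then interpret g: represented B "code_verts V" code_side "code_R1 E S" "code_R2 E S" g \<kappa>
        using is_structure_B by unfold_locales
      have "Aut_graph V E \<cong> Schuetzenberger_group ?M H"
        using iso_trans[OF Aut_graph_iso_code[OF assms(1)] g.Schuetzenberger_iso]
        unfolding g(2) g.H_def .
      then show ?thesis by (rule is_iso_sym_closed) (rule Aut_graph_closed)
    qed
    moreover have "D S \<in> carrier ?M // Green_D ?M"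
      unfolding D_def using f_End by (rule quotientI)
    ultimately show ?thesis by (simp add: nonregular_D_classes_def)
  qed
  moreover have "inj D"
  proof (rule injI)
    \<comment> \<open>If the classes agree, \<open>f S'\<close> represents the codes of both sets;
      these are then isomorphic, and the fixed ray reads off equal sets.\<close>
    fix S S' assume "D S = D S'"
    then have "f S' \<in> D S" using Green_D_refl[OF f_End] by (simp add: D_def)
    then obtain \<kappa> where "?rep S (f S') \<kappa>" using D_rep by blast
    then interpret r: represented B "code_verts V" code_side "code_R1 E S" "code_R2 E S" "f S'" \<kappa>
      using is_structure_B by unfold_locales
    obtain \<phi> where "code_iso V E S S' \<phi>" using r.represents_unique[OF f] by blast
    then show "S = S'" by (rule code_iso_same_set[OF irr])
  qed
  ultimately show "(UNIV :: nat set set) \<lesssim> ?X"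
    unfolding lepoll_def by (intro exI[of _ D]) auto
qed

end
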